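(* Let $f(x_1,\dots,x_{n-1})\in\mathbb{Z}[x_1^{\pm1},\dots,x_{n-1}^{\pm1}]$ be a Laurent polynomial with integer coefficients satisfying the following condition (H): there exists an index $i$ such that, when $f$ is written as a Laurent polynomial in $x_i$ with coefficients in the ring of Laurent polynomials in the other variables, the coefficient of the term of highest degree in $x_i$ is a monomial in the other variables $x_1,\dots,\widehat{x_i},\dots,x_{n-1}$. Then the fractional parts of $f(p_1,\dots,p_{n-1})/q$, for $(q;p_1,\dots,p_{n-1})\in I_n$, are equidistributed in $[0,1)$: for every nonzero integer $k$, $$\lim_{x\to\infty}\frac1{|I_n(x)|}\sum_{(q;p_1,\dots,p_{n-1})\in I_n(x)}\exp\!\left(\frac{2\pi i k}{q}f(p_1,\dots,p_{n-1})\right)=0 .$$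
   Context: $I_n$ is the set of $(q;p_1,\dots,p_{n-1})\in\mathbb{Z}_{>0}^n$ such that $p_1,\dots,p_{n-1}<q$ and each $p_i$ is relatively prime to $q$; for real $x>0$, $I_n(x)$ is the set of those elements with $q<x$. In $f(p_1,\dots,p_{n-1})$, the symbol $p_i^{-1}$ means any integer inverse to $p_i$ modulo $q$, so that $f(p_1,\dots,p_{n-1})$ is an integer well defined modulo $q$. A monomial means a nonzero integer constant times a product of (possibly negative or zero) powers of the variables. In the exponential, $i$ denotes $\sqrt{-1}$.
   Formalization: The formal theorem additionally assumes that f is not an integer constant: a nonzero constant f = c satisfies (H), but the averages of exp(2πikc/q) tend to 1 rather than 0, so the claim fails exactly for those f. *)

theory Defs
  imports
    "HOL-Analysis.Analysis"
    "HOL-Number_Theory.Modular_Inverse"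
    "HOL-Library.Poly_Mapping"
begin

text \<open>
  A Laurent polynomial with integer coefficients is an element of the group ring over the integers
  of the free abelian group of exponent vectors: the exponent vector \<open>m\<close> stands for the product
  of the \<open>x\<^sub>i\<close> to the power \<open>lookup m i\<close>, and \<open>lookup f m\<close> is its coefficient in \<open>f\<close>.
  The variables are indexed by natural numbers; \<open>laurent_over\<close> bounds those that may occur.
\<close>

type_synonym exponent = "nat \<Rightarrow>\<^sub>0 int"
type_synonym laurent = "exponent \<Rightarrow>\<^sub>0 int"

definition laurent_over :: "nat set \<Rightarrow> laurent set" where
  "laurent_over V = {f. \<forall>m \<in> Poly_Mapping.keys f. Poly_Mapping.keys m \<subseteq> V}"

definition laurent_monomial :: "laurent \<Rightarrow> bool" where
  "laurent_monomial g \<longleftrightarrow> (\<exists>m c. c \<noteq> 0 \<and> g = Poly_Mapping.single m c)"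

text \<open>The coefficient of \<open>x\<^sub>i\<close> to the power \<open>d\<close>, a Laurent polynomial in the other variables.\<close>

definition coeff_wrt :: "nat \<Rightarrow> int \<Rightarrow> laurent \<Rightarrow> laurent" where
  "coeff_wrt i d f =
     (\<Sum>m \<in> {m \<in> Poly_Mapping.keys f. Poly_Mapping.lookup m i = d}.
        Poly_Mapping.single (m - Poly_Mapping.single i d) (Poly_Mapping.lookup f m))"

text \<open>The exponents of \<open>x\<^sub>i\<close> that occur in \<open>f\<close>; the degree is unspecified for \<open>f = 0\<close>.\<close>

definition exponents_wrt :: "nat \<Rightarrow> laurent \<Rightarrow> int set" where
  "exponents_wrt i f = (\<lambda>m. Poly_Mapping.lookup m i) ` Poly_Mapping.keys f"

definition degree_wrt :: "nat \<Rightarrow> laurent \<Rightarrow> int" where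
  "degree_wrt i f = Max (exponents_wrt i f)"

definition lead_coeff_wrt :: "nat \<Rightarrow> laurent \<Rightarrow> laurent" where
  "lead_coeff_wrt i f = coeff_wrt i (degree_wrt i f) f"

lemma coeff_wrt_expansion:
  "f = (\<Sum>d \<in> exponents_wrt i f.
          coeff_wrt i d f * Poly_Mapping.single (Poly_Mapping.single i d) 1)"
proof -
  have "(\<Sum>d \<in> exponents_wrt i f.
          coeff_wrt i d f * Poly_Mapping.single (Poly_Mapping.single i d) 1)
      = (\<Sum>d \<in> exponents_wrt i f. \<Sum>m \<in> {m \<in> Poly_Mapping.keys f. Poly_Mapping.lookup m i = d}.
          Poly_Mapping.single m (Poly_Mapping.lookup f m))"
    by (simp add: coeff_wrt_def sum_distrib_right mult_single)
  also have "\<dots> = (\<Sum>m \<in> Poly_Mapping.keys f. Poly_Mapping.single m (Poly_Mapping.lookup f m))"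
    unfolding exponents_wrt_def
    by (rule sum.group) auto
  also have "\<dots> = f"
    by (rule poly_mapping_eqI)
       (auto simp: lookup_sum lookup_single when_def in_keys_iff)
  finally show ?thesis by simp
qed

lemma coeff_wrt_over:
  assumes "f \<in> laurent_over V"
  shows "coeff_wrt i d f \<in> laurent_over (V - {i})"
proof -
  have "Poly_Mapping.keys m \<subseteq> V - {i}" if "m \<in> Poly_Mapping.keys (coeff_wrt i d f)" for m
  proof -
    from that have "Poly_Mapping.lookup (coeff_wrt i d f) m \<noteq> 0"
      by (simp add: in_keys_iff)
    then obtain m' where m': "m' \<in> Poly_Mapping.keys f" "Poly_Mapping.lookup m' i = d"
        "m = m' - Poly_Mapping.single i d"
      unfolding coeff_wrt_def lookup_sum
      by (auto elim!: sum.not_neutral_contains_not_neutral simp: lookup_single when_def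
               split: if_splits)
    have "Poly_Mapping.keys m' \<subseteq> V"
      using assms m'(1) by (auto simp: laurent_over_def)
    then show ?thesis
      using m' by (auto simp: in_keys_iff lookup_minus lookup_single when_def split: if_splits)
  qed
  then show ?thesis by (auto simp: laurent_over_def)
qed

text \<open>
  The value of \<open>f\<close> at \<open>x\<close>, where the integer \<open>r i\<close> is used in place of the inverse of \<open>x i\<close>.
\<close>

definition laurent_eval :: "(nat \<Rightarrow> int) \<Rightarrow> (nat \<Rightarrow> int) \<Rightarrow> laurent \<Rightarrow> int" where
  "laurent_eval x r f =
     (\<Sum>m \<in> Poly_Mapping.keys f. Poly_Mapping.lookup f m *
        (\<Prod>i \<in> Poly_Mapping.keys m.
           let e = Poly_Mapping.lookup m i in if e \<ge> 0 then x i ^ nat e else r i ^ nat (- e)))"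

definition laurent_value :: "nat \<Rightarrow> (nat \<Rightarrow> nat) \<Rightarrow> laurent \<Rightarrow> int" where
  "laurent_value q p f =
     laurent_eval (\<lambda>i. int (p i)) (\<lambda>i. modular_inverse (int q) (int (p i))) f"

text \<open>The class of the value modulo \<open>q\<close> does not depend on the inverses chosen.\<close>

lemma laurent_value_cong:
  assumes "f \<in> laurent_over V" and r: "\<And>i. i \<in> V \<Longrightarrow> [int (p i) * r i = 1] (mod int q)"
  shows "[laurent_eval (\<lambda>i. int (p i)) r f = laurent_value q p f] (mod int q)"
proof -
  have inv: "[r i = modular_inverse (int q) (int (p i))] (mod int q)" if "i \<in> V" for i
  proof -
    let ?s = "modular_inverse (int q) (int (p i))"
    have "coprime (int (p i)) (int q)"
      using r[OF that] coprime_iff_invertible_int by blast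
    then have s: "[int (p i) * ?s = 1] (mod int q)"
      by (rule cong_modular_inverse1)
    have "[int (p i) * ?s * r i = 1 * r i] (mod int q)"
      using s by (rule cong_scalar_right)
    moreover have "[int (p i) * r i * ?s = 1 * ?s] (mod int q)"
      using r[OF that] by (rule cong_scalar_right)
    moreover have "int (p i) * ?s * r i = int (p i) * r i * ?s"
      by (simp add: mult_ac)
    ultimately show ?thesis
      by (metis cong_sym cong_trans mult_1)
  qed
  have "i \<in> V" if "m \<in> Poly_Mapping.keys f" "i \<in> Poly_Mapping.keys m" for i m
    using assms(1) that by (auto simp: laurent_over_def)
  then show ?thesis
    unfolding laurent_value_def laurent_eval_def Let_def
    by (intro cong_sum cong_mult cong_prod cong_refl) (auto intro!: cong_pow inv)
qed

text \<open>
  Tuples \<open>(q; p\<^sub>1, \<dots>, p\<^sub>n\<^sub>-\<^sub>1)\<close> are pairs of \<open>q\<close> and an extensional function on \<open>{1..<n}\<close>.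
\<close>

definition I_set :: "nat \<Rightarrow> (nat \<times> (nat \<Rightarrow> nat)) set" where
  "I_set n = {(q, p). 0 < q \<and> p \<in> extensional {1..<n} \<and>
                      (\<forall>i \<in> {1..<n}. 0 < p i \<and> p i < q \<and> coprime (p i) q)}"

definition I_below :: "nat \<Rightarrow> real \<Rightarrow> (nat \<times> (nat \<Rightarrow> nat)) set" where
  "I_below n x = {t \<in> I_set n. real (fst t) < x}"

lemma finite_I_below: "finite (I_below n x)"
proof (rule finite_subset)
  show "I_below n x \<subseteq> {..nat \<lceil>x\<rceil>} \<times> ({1..<n} \<rightarrow>\<^sub>E {..nat \<lceil>x\<rceil>})"
  proof
    fix t assume "t \<in> I_below n x"
    then obtain q p where t: "t = (q, p)" and qp: "(q, p) \<in> I_set n" and q: "real q < x"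
      by (cases t) (auto simp: I_below_def)
    from q have "q \<le> nat \<lceil>x\<rceil>" by linarith
    moreover have "p i \<le> q" if "i \<in> {1..<n}" for i
    proof -
      from qp that have "p i < q" unfolding I_set_def by blast
      then show ?thesis by simp
    qed
    ultimately have "\<forall>i \<in> {1..<n}. p i \<le> nat \<lceil>x\<rceil>"
      using le_trans by blast
    moreover have "p \<in> extensional {1..<n}"
      using qp unfolding I_set_def by blast
    ultimately show "t \<in> {..nat \<lceil>x\<rceil>} \<times> ({1..<n} \<rightarrow>\<^sub>E {..nat \<lceil>x\<rceil>})"
      unfolding t PiE_def Pi_def using \<open>q \<le> nat \<lceil>x\<rceil>\<close> by blast
  qed
  show "finite ({..nat \<lceil>x\<rceil>} \<times> ({1..<n} \<rightarrow>\<^sub>E {..nat \<lceil>x\<rceil>}))"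
    by (intro finite_cartesian_product finite_PiE) auto
qed

text \<open>
  The values of \<open>u\<close> in \<open>[0,1)\<close>, taken over the growing finite sets \<open>A x\<close>, are equidistributed:
  every subinterval receives asymptotically its length as proportion.
\<close>

definition equidistributed :: "(real \<Rightarrow> 'a set) \<Rightarrow> ('a \<Rightarrow> real) \<Rightarrow> bool" where
  "equidistributed A u \<longleftrightarrow>
     (\<forall>a b. 0 \<le> a \<and> a \<le> b \<and> b \<le> 1 \<longrightarrow>
        ((\<lambda>x. real (card {t \<in> A x. u t \<in> {a..<b}}) / real (card (A x))) \<longlongrightarrow> b - a) at_top)"

end

theory Submission
  imports
    Defs
    "HOL-Number_Theory.Number_Theory"
    "HOL-Computational_Algebra.Computational_Algebra"
    "HOL-Real_Asymp.Real_Asymp"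
begin

text \<open>
  For a modulus \<open>q = p r\<close> with a large prime \<open>p\<close> not dividing \<open>r\<close>, average the sum over all tuples
  along \<open>x\<^sub>i \<mapsto> x\<^sub>i t^w\<^sub>i\<close>, where \<open>t\<close> is a unit modulo \<open>p\<close> and \<open>1\<close> modulo \<open>r\<close>. For generic weights
  \<open>w\<^sub>i\<close> some nonconstant monomial of \<open>f\<close> has a weighted degree that is nonzero and different from
  those of the others, so each inner sum is a one-variable Laurent sum modulo \<open>p\<close> with a
  nonvanishing coefficient. Mordell's method (the \<open>2 K\<close>-th moment over all coefficient vectors,
  together with the orbit of a vector under \<open>a\<^sub>j \<mapsto> a\<^sub>j l^j\<close>) bounds it by \<open>o(p)\<close> uniformly in the
  coefficients. Almost all \<open>q\<close> have such a prime factor, and the exceptional ones are negligible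
  because \<open>\<Sum> \<phi>(q)^(n-1)\<close> over \<open>q < x\<close> is at least a constant times \<open>x^n\<close>. Equidistribution then
  follows from Weyl's criterion.
\<close>

hide_const (open) up_ring.coeff

section \<open>Power sums and elementary symmetric functions modulo a prime\<close>

text \<open>Exponents of both signs occur, so the power sums cannot come from a single range
  \<open>1, ..., K\<close> that would determine the \<open>K\<close> variables by Newton's
  identities. Instead they give coefficients at the two ends of the polynomial with these roots, and
  the product of the variables links the ends. The \<open>2 D\<close> nonzero exponents in
  \<open>[-D, D]\<close> and the product are \<open>K = 2 D + 1\<close> conditions on
  \<open>K\<close> variables. Up to constants there are thus at most \<open>p^(K + 1)\<close> pairs
  with equal power sums, and the total moment is at most \<open>p^(2 D) p^(K + 1) = p^(2 K)\<close>.
  An orbit has at least \<open>(p - 1) / D\<close> members with the same sum, which gains a factor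
  \<open>p\<close> in the \<open>2 K\<close>-th power and bounds a single sum by a constant times
  \<open>p^(1 - 1/(2 K))\<close>. This weak saving suffices: \<open>D\<close> depends on
  \<open>f\<close> alone, so a lower bound \<open>M\<close> for \<open>p\<close> can be fixed before
  \<open>x\<close> grows, and the exceptional moduli then have upper density at most
  \<open>1/M\<close>. The prime must divide \<open>q\<close> exactly once, so that a unit modulo
  \<open>p\<close> can vary while the residue modulo the cofactor stays fixed.\<close>

text \<open>The logarithmic derivative of the product is minus the generating series of the power
  sums. Multiplied out it needs no division and so holds over every commutative ring.\<close>

lemma fps_deriv_prod_linear:
  fixes x :: "'a \<Rightarrow> 'b::comm_ring_1"
  assumes "finite S"
  shows "fps_deriv (\<Prod>l\<in>S. 1 - fps_const (x l) * fps_X)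
           = - (\<Prod>l\<in>S. 1 - fps_const (x l) * fps_X) * Abs_fps (\<lambda>m. \<Sum>l\<in>S. x l ^ Suc m)"
  using assms
proof (induction S rule: finite_induct)
  case empty
  then show ?case by (simp add: fps_eq_iff)
next
  case (insert a S)
  define F where "F = (\<Prod>l\<in>S. 1 - fps_const (x l) * fps_X)"
  define G where "G = Abs_fps (\<lambda>m. \<Sum>l\<in>S. x l ^ Suc m)"
  define L where "L = 1 - fps_const (x a) * fps_X"
  define H where "H = Abs_fps (\<lambda>m. x a ^ Suc m)"
  \<comment> \<open>\<open>H\<close> is the geometric series of
    \<open>x a / (1 - x a X)\<close>.\<close>
  have LH: "L * H = fps_const (x a)"
  proof (rule fps_ext)
    fix n
    have "L * H = H - fps_const (x a) * (fps_X * H)"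
      unfolding L_def by (simp only: left_diff_distrib mult_1 mult.assoc)
    then show "fps_nth (L * H) n = fps_nth (fps_const (x a)) n"
      by (cases n) (simp_all add: H_def)
  qed
  have G': "Abs_fps (\<lambda>m. \<Sum>l\<in>insert a S. x l ^ Suc m) = H + G"
    using insert by (simp add: fps_eq_iff G_def H_def)
  have F': "(\<Prod>l\<in>insert a S. 1 - fps_const (x l) * fps_X) = L * F"
    using insert by (simp add: F_def L_def)
  have dL: "fps_deriv L = - fps_const (x a)"
    by (simp add: L_def)
  have IH: "fps_deriv F = - F * G" using insert.IH unfolding F_def G_def .
  have "L * (- F * G) + - fps_const (x a) * F = - (L * F) * (H + G)"
    unfolding LH[symmetric] by (simp only: ring_distribs mult_minus_left mult_minus_right minus_add_distrib ac_simps)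
  then show ?case unfolding G' F' fps_deriv_mult dL IH .
qed

text \<open>This compares the coefficients of \<open>X^j\<close> in the logarithmic derivative. Up
  to sign, the coefficients of \<open>P\<close> are the elementary symmetric functions.\<close>

lemma newton_identity:
  fixes x :: "'a \<Rightarrow> 'b::comm_ring_1" and S :: "'a set"
  defines "P \<equiv> \<Prod>l\<in>S. [:1, - x l:]"
  assumes "finite S"
  shows "of_nat (Suc j) * coeff P (Suc j)
           = - (\<Sum>i\<le>j. coeff P i * (\<Sum>l\<in>S. x l ^ Suc (j - i)))"
proof -
  have P: "fps_of_poly P = (\<Prod>l\<in>S. 1 - fps_const (x l) * fps_X)"
    unfolding P_def fps_of_poly_prod
  proof (rule prod.cong)
    fix l show "fps_of_poly [:1, - x l:] = 1 - fps_const (x l) * fps_X"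
      by (rule fps_ext) (auto simp: coeff_pCons split: nat.split)
  qed simp
  have "fps_nth (fps_deriv (fps_of_poly P)) j
        = fps_nth (- fps_of_poly P * Abs_fps (\<lambda>m. \<Sum>l\<in>S. x l ^ Suc m)) j"
    unfolding P by (rule arg_cong[OF fps_deriv_prod_linear[OF assms(2)]])
  then have "of_nat (j + 1) * coeff P (j + 1)
      = (\<Sum>i=0..j. - coeff P i * (\<Sum>l\<in>S. x l ^ Suc (j - i)))"
    unfolding fps_deriv_nth fps_mult_nth fps_neg_nth fps_of_poly_nth fps_nth_Abs_fps .
  then show ?thesis
    unfolding mult_minus_left sum_negf atLeast0AtMost Suc_eq_plus1 .
qed

text \<open>Newton's identity expresses \<open>j\<close> times the \<open>j\<close>-th coefficient
  by earlier ones and power sums, and \<open>j \<le> D < p\<close> makes \<open>j\<close> invertible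
  modulo \<open>p\<close>.\<close>

lemma power_sums_determine_coeffs:
  fixes x y :: "'a \<Rightarrow> int" and p D :: nat
  assumes "finite S" "prime p" "D < p"
    and s: "\<And>j. 1 \<le> j \<Longrightarrow> j \<le> D \<Longrightarrow> [(\<Sum>l\<in>S. x l ^ j) = (\<Sum>l\<in>S. y l ^ j)] (mod int p)"
    and "j \<le> D"
  shows "[coeff (\<Prod>l\<in>S. [:1, - x l:]) j = coeff (\<Prod>l\<in>S. [:1, - y l:]) j] (mod int p)"
  using \<open>j \<le> D\<close>
proof (induction j rule: less_induct)
  case (less j)
  define P where "P = (\<Prod>l\<in>S. [:1, - x l:])"
  define Q where "Q = (\<Prod>l\<in>S. [:1, - y l:])"
  show ?case
  proof (cases j)
    case 0
    have "coeff (\<Prod>l\<in>S. [:1, - z l:]) 0 = 1" for z :: "'a \<Rightarrow> int"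
      by (simp flip: poly_0_coeff_0 add: poly_prod)
    then show ?thesis by (simp add: 0)
  next
    case (Suc i)
    have "[(\<Sum>m\<le>i. coeff P m * (\<Sum>l\<in>S. x l ^ Suc (i - m)))
           = (\<Sum>m\<le>i. coeff Q m * (\<Sum>l\<in>S. y l ^ Suc (i - m)))] (mod int p)"
      unfolding P_def Q_def
    proof (rule cong_sum, rule cong_mult)
      fix m assume "m \<in> {..i}"
      then show "[coeff (\<Prod>l\<in>S. [:1, - x l:]) m = coeff (\<Prod>l\<in>S. [:1, - y l:]) m] (mod int p)"
        using less.prems Suc by (intro less.IH) auto
      show "[(\<Sum>l\<in>S. x l ^ Suc (i - m)) = (\<Sum>l\<in>S. y l ^ Suc (i - m))] (mod int p)"
        using less.prems Suc by (intro s) auto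
    qed
    then have "[- (\<Sum>m\<le>i. coeff P m * (\<Sum>l\<in>S. x l ^ Suc (i - m)))
           = - (\<Sum>m\<le>i. coeff Q m * (\<Sum>l\<in>S. y l ^ Suc (i - m)))] (mod int p)"
      by (simp only: cong_minus_minus_iff)
    then have c: "[of_nat (Suc i) * coeff P (Suc i) = of_nat (Suc i) * coeff Q (Suc i)] (mod int p)"
      unfolding P_def Q_def
      by (simp only: newton_identity[OF \<open>finite S\<close>, of i x] newton_identity[OF \<open>finite S\<close>, of i y])
    have "\<not> p dvd Suc i"
      using Suc less.prems assms(3) by (auto dest: dvd_imp_le)
    then have "coprime (Suc i) p"
      using prime_imp_coprime[OF assms(2)] by (simp only: coprime_commute[of "Suc i"])
    then have "coprime (int (Suc i)) (int p)"
      by (simp only: coprime_int_iff)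
    with c have "[coeff P (Suc i) = coeff Q (Suc i)] (mod int p)"
      by (simp only: cong_mult_lcancel)
    then show ?thesis unfolding Suc P_def Q_def .
  qed
qed

text \<open>Divisibility by the constant polynomial \<open>[:c:]\<close> encodes coefficientwise
  congruence modulo \<open>c\<close>, which is compatible with products.\<close>

lemma const_poly_dvd_diff_prod:
  fixes A B :: "'a \<Rightarrow> int poly"
  assumes "\<And>l. l \<in> S \<Longrightarrow> [:c:] dvd A l - B l"
  shows "[:c:] dvd (\<Prod>l\<in>S. A l) - (\<Prod>l\<in>S. B l)"
  using assms
proof (induction S rule: infinite_finite_induct)
  case (insert a S)
  have "A a * (\<Prod>l\<in>S. A l) - B a * (\<Prod>l\<in>S. B l)
      = (A a - B a) * (\<Prod>l\<in>S. A l) + B a * ((\<Prod>l\<in>S. A l) - (\<Prod>l\<in>S. B l))"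
    by (simp add: algebra_simps)
  moreover have "[:c:] dvd (A a - B a) * (\<Prod>l\<in>S. A l)"
    by (rule dvd_mult2) (use insert in auto)
  moreover have "[:c:] dvd B a * ((\<Prod>l\<in>S. A l) - (\<Prod>l\<in>S. B l))"
    by (rule dvd_mult) (use insert in auto)
  ultimately show ?case using insert by (simp del: mult_pCons_left mult_pCons_right)
qed auto

text \<open>The two products are reciprocal polynomials of each other.\<close>

lemma coeff_monic_prod_high:
  fixes x :: "'a \<Rightarrow> int"
  assumes "finite S" "i \<le> card S"
  shows "coeff (\<Prod>l\<in>S. [:- x l, 1:]) (card S - i) = coeff (\<Prod>l\<in>S. [:1, - x l:]) i"
proof -
  have deg: "degree (\<Prod>l\<in>S. [:- x l, 1:]) = card S"
    using assms(1) by (subst degree_prod_eq_sum_degree) auto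
  have "reflect_poly [:- x l, 1:] = [:1, - x l:]" for l
    by (cases "x l = 0") (auto simp: reflect_poly_def )
  then have "(\<Prod>l\<in>S. [:1, - x l:]) = reflect_poly (\<Prod>l\<in>S. [:- x l, 1:])"
    by (simp add: reflect_poly_prod)
  then show ?thesis
    using assms by (simp add: coeff_reflect_poly deg)
qed

text \<open>Modulo \<open>c\<close> each factor \<open>X - x l\<close> equals
  \<open>- x l (1 - x' l X)\<close>.\<close>

lemma coeff_monic_prod_low:
  fixes x x' :: "'a \<Rightarrow> int"
  assumes inv: "\<And>l. l \<in> S \<Longrightarrow> [x l * x' l = 1] (mod c)"
  shows "[coeff (\<Prod>l\<in>S. [:- x l, 1:]) i
          = (\<Prod>l\<in>S. - x l) * coeff (\<Prod>l\<in>S. [:1, - x' l:]) i] (mod c)"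
proof -
  have "[:c:] dvd [:- x l, 1:] - [:- x l:] * [:1, - x' l:]" if "l \<in> S" for l
    using inv[OF that]
    by (auto simp: const_poly_dvd_iff coeff_pCons cong_iff_dvd_diff dvd_diff_commute mult.commute split: nat.split)
  then have "[:c:] dvd (\<Prod>l\<in>S. [:- x l, 1:]) - (\<Prod>l\<in>S. [:- x l:] * [:1, - x' l:])"
    by (rule const_poly_dvd_diff_prod)
  also have "(\<Prod>l\<in>S. [:- x l:] * [:1, - x' l:]) = (\<Prod>l\<in>S. [:- x l:]) * (\<Prod>l\<in>S. [:1, - x' l:])"
    by (rule prod.distrib)
  also have "(\<Prod>l\<in>S. [:- x l:]) = [:\<Prod>l\<in>S. - x l:]"
    by (induction S rule: infinite_finite_induct) (auto simp: one_pCons)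
  finally show ?thesis
    by (simp add: const_poly_dvd_iff cong_iff_dvd_diff)
qed

text \<open>
  The power sums of the \<open>x\<^sub>l\<close> determine the \<open>D + 1\<close> highest coefficients of \<open>\<Prod>(X - x\<^sub>l)\<close>, those of
  the inverses \<open>x'\<^sub>l\<close> together with \<open>\<Prod>x\<^sub>l\<close> the \<open>D + 1\<close> lowest. For \<open>2 D + 1\<close> variables these are all
  coefficients.
\<close>

lemma power_sums_determine_tuple:
  fixes x y x' y' :: "'a \<Rightarrow> int" and p D :: nat
  assumes "finite S" "card S = 2 * D + 1" "prime p" "D < p"
    and s: "\<And>j. 1 \<le> j \<Longrightarrow> j \<le> D \<Longrightarrow> [(\<Sum>l\<in>S. x l ^ j) = (\<Sum>l\<in>S. y l ^ j)] (mod int p)"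
    and s': "\<And>j. 1 \<le> j \<Longrightarrow> j \<le> D \<Longrightarrow> [(\<Sum>l\<in>S. x' l ^ j) = (\<Sum>l\<in>S. y' l ^ j)] (mod int p)"
    and inv: "\<And>l. l \<in> S \<Longrightarrow> [x l * x' l = 1] (mod int p)"
    and inv': "\<And>l. l \<in> S \<Longrightarrow> [y l * y' l = 1] (mod int p)"
    and prod: "[(\<Prod>l\<in>S. x l) = (\<Prod>l\<in>S. y l)] (mod int p)"
    and "m \<in> S"
  shows "\<exists>l\<in>S. [x m = y l] (mod int p)"
proof -
  define P where "P = (\<Prod>l\<in>S. [:- x l, 1:])"
  define Q where "Q = (\<Prod>l\<in>S. [:- y l, 1:])"
  have deg: "degree P = card S" "degree Q = card S"
    unfolding P_def Q_def using assms(1) by (simp_all add: degree_prod_eq_sum_degree)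
  have "[coeff P i = coeff Q i] (mod int p)" for i
  proof -
    consider "i \<le> D" | "D < i" "i \<le> card S" | "card S < i" by linarith
    then show ?thesis
    proof cases
      case 1
      have "[(\<Prod>l\<in>S. - x l) = (\<Prod>l\<in>S. - y l)] (mod int p)"
      proof -
        have "(\<Prod>l\<in>S. - z l) = (-1) ^ card S * (\<Prod>l\<in>S. z l)" for z :: "'a \<Rightarrow> int"
          by (rule prod_uminus)
        then show ?thesis using prod by (simp only: cong_scalar_left)
      qed
      moreover have "[coeff (\<Prod>l\<in>S. [:1, - x' l:]) i = coeff (\<Prod>l\<in>S. [:1, - y' l:]) i] (mod int p)"
        by (rule power_sums_determine_coeffs[OF assms(1,3,4) s' 1])
      ultimately have "[(\<Prod>l\<in>S. - x l) * coeff (\<Prod>l\<in>S. [:1, - x' l:]) i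
         = (\<Prod>l\<in>S. - y l) * coeff (\<Prod>l\<in>S. [:1, - y' l:]) i] (mod int p)"
        by (rule cong_mult)
      then show ?thesis
        unfolding P_def Q_def
        using coeff_monic_prod_low[of S x x' "int p" i, OF inv] coeff_monic_prod_low[of S y y' "int p" i, OF inv']
        by (meson cong_sym cong_trans)
    next
      case 2
      then have "card S - i \<le> D" "card S - (card S - i) = i" "card S - i \<le> card S"
        using assms(2) by auto
      then show ?thesis
        using power_sums_determine_coeffs[OF assms(1,3,4) s, of "card S - i"]
          coeff_monic_prod_high[OF assms(1), of "card S - i" x]
          coeff_monic_prod_high[OF assms(1), of "card S - i" y]
        unfolding P_def Q_def by simp
    next
      case 3
      then show ?thesis using deg by (simp add: coeff_eq_0)
    qed
  qed
  \<comment> \<open>As \<open>P\<close> and \<open>Q\<close> agree modulo \<open>p\<close>, the root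
    \<open>x m\<close> of \<open>P\<close> is a root of \<open>Q\<close> modulo \<open>p\<close>;
    primality then picks out one factor of \<open>Q\<close>.\<close>
  then have "[poly P (x m) = poly Q (x m)] (mod int p)"
    unfolding poly_altdef deg by (intro cong_sum cong_mult) auto
  moreover have "poly P (x m) = 0"
    unfolding P_def poly_prod using assms(1) \<open>m \<in> S\<close> by (auto intro!: prod_zero)
  ultimately have "int p dvd (\<Prod>l\<in>S. x m - y l)"
    unfolding Q_def poly_prod by (simp add: cong_0_iff cong_sym_eq[of 0])
  then obtain l where "l \<in> S" "int p dvd x m - y l"
    using assms(1,3) by (subst (asm) prime_dvd_prod_iff) auto
  then show ?thesis by (auto simp: cong_iff_dvd_diff)
qed

section \<open>Additive characters and moments of exponential sums\<close>

definition add_char :: "nat \<Rightarrow> int \<Rightarrow> complex" where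
  "add_char m z = cis (2 * pi * of_int z / of_nat m)"

lemma norm_add_char [simp]: "norm (add_char m z) = 1"
  by (simp add: add_char_def)

lemma add_char_0 [simp]: "add_char m 0 = 1"
  by (simp add: add_char_def)

lemma add_char_add: "add_char m (y + z) = add_char m y * add_char m z"
  by (simp add: add_char_def cis_mult add_divide_distrib ring_distribs)

lemma add_char_sum: "add_char m (\<Sum>i\<in>A. f i) = (\<Prod>i\<in>A. add_char m (f i))"
  by (induction A rule: infinite_finite_induct) (auto simp: add_char_add)

lemma add_char_mult_nat: "add_char m (int a * z) = add_char m z ^ a"
  by (induction a) (auto simp: add_char_add ring_distribs)

lemma add_char_uminus: "add_char m (- z) = cnj (add_char m z)"
  by (simp add: add_char_def cis_cnj)

lemma add_char_eq_1_iff: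
  assumes "m > 0"
  shows "add_char m z = 1 \<longleftrightarrow> int m dvd z"
proof
  assume "add_char m z = 1"
  then have "cos (2 * pi * of_int z / of_nat m) = 1"
    by (simp add: add_char_def cis.ctr complex_eq_iff)
  then obtain k :: int where "2 * pi * of_int z / of_nat m = of_int k * 2 * pi"
    by (auto simp: cos_one_2pi_int)
  then have "of_int z = (of_int k * of_nat m :: real)"
    using assms by (simp add: field_simps)
  then have "z = k * int m"
    by (metis of_int_eq_iff of_int_mult of_int_of_nat_eq)
  then show "int m dvd z" by simp
next
  assume "int m dvd z"
  then obtain k where "z = int m * k" by auto
  then have "2 * pi * of_int z / of_nat m = 2 * pi * of_int k"
    using assms by simp
  then show "add_char m z = 1"
    by (simp add: add_char_def cis_multiple_2pi)
qed

lemma add_char_cong: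
  assumes "m > 0" "[y = z] (mod int m)"
  shows "add_char m y = add_char m z"
proof -
  have "add_char m (y - z) = 1"
    using assms by (simp add: add_char_eq_1_iff cong_iff_dvd_diff)
  then show ?thesis
    using add_char_add[of m "y - z" z] by simp
qed

lemma add_char_orthogonality:
  assumes "m > 0"
  shows "(\<Sum>a<m. add_char m (int a * h)) = (if int m dvd h then of_nat m else 0)"
proof (cases "int m dvd h")
  case True
  then show ?thesis using assms by (simp add: add_char_mult_nat add_char_eq_1_iff[THEN iffD2])
next
  case False
  have "add_char m h ^ m = 1"
    using assms by (simp add: add_char_eq_1_iff flip: add_char_mult_nat)
  then show ?thesis
    using False assms by (simp add: add_char_mult_nat geometric_sum add_char_eq_1_iff)
qed

section \<open>Laurent sums modulo a prime and their dilations\<close>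

text \<open>By Fermat, \<open>t ^ unit_exp p j\<close> stands for the integer power
  \<open>t^j\<close> of a unit, so negative \<open>j\<close> need no inverses.\<close>

definition unit_exp :: "nat \<Rightarrow> int \<Rightarrow> nat" where
  "unit_exp p j = nat (j mod int (p - 1))"

lemma cong_unit_exp: "p > 1 \<Longrightarrow> [int (unit_exp p j) = j] (mod int (p - 1))"
  by (simp add: unit_exp_def cong_def)

lemma power_cong_exponent:
  assumes "prime p" "\<not> p dvd t" "[a = b] (mod (p - 1))"
  shows "[int t ^ a = int t ^ b] (mod int p)"
proof -
  have "coprime p t" using assms by (simp add: prime_imp_coprime)
  have "ord p t dvd p - 1"
    using fermat_theorem[OF assms(1,2)] ord_divides by blast
  then have "[a = b] (mod ord p t)"
    using assms(3) cong_dvd_modulus_nat by blast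
  then have "[t ^ a = t ^ b] (mod p)"
    using \<open>coprime p t\<close> by (simp add: order_divides_expdiff)
  then show ?thesis by (metis cong_int_iff of_nat_power)
qed

lemma bij_betw_mult_mod_prime:
  assumes "prime p" "\<not> p dvd (l::nat)"
  shows "bij_betw (\<lambda>t. l * t mod p) {1..<p} {1..<p}"
proof -
  have cop: "coprime l p" using assms by (metis coprime_commute prime_imp_coprime)
  have inj: "inj_on (\<lambda>t. l * t mod p) {1..<p}"
  proof (rule inj_onI)
    fix s t assume st: "s \<in> {1..<p}" "t \<in> {1..<p}" "l * s mod p = l * t mod p"
    then have "[s = t] (mod p)" using cop by (metis cong_def cong_mult_lcancel_nat)
    then show "s = t" using st by (simp add: cong_def)
  qed
  have "(\<lambda>t. l * t mod p) ` {1..<p} \<subseteq> {1..<p}"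
  proof
    fix u assume "u \<in> (\<lambda>t. l * t mod p) ` {1..<p}"
    then obtain t where t: "t \<in> {1..<p}" "u = l * t mod p" by auto
    then have "\<not> p dvd t" by (auto dest: dvd_imp_le)
    then have "\<not> p dvd l * t" using assms by (simp add: prime_dvd_mult_iff)
    then show "u \<in> {1..<p}" using t(2) assms(1) prime_gt_0_nat[of p]
      by (auto simp: dvd_eq_mod_eq_0 Suc_le_eq)
  qed
  with inj show ?thesis
    by (simp add: bij_betw_def endo_inj_surj)
qed

text \<open>The exponent set \<open>J\<close> is kept apart from the coefficient vector
  \<open>a\<close> because moments are taken over all \<open>a\<close> with \<open>J\<close>
  fixed.\<close>

definition laurent_sum :: "nat \<Rightarrow> int set \<Rightarrow> (int \<Rightarrow> int) \<Rightarrow> complex" where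
  "laurent_sum p J a = (\<Sum>t\<in>{1..<p}. add_char p (\<Sum>j\<in>J. a j * int t ^ unit_exp p j))"

lemma laurent_sum_cong:
  assumes "p > 0" "\<And>j. j \<in> J \<Longrightarrow> [a j = b j] (mod int p)"
  shows "laurent_sum p J a = laurent_sum p J b"
  unfolding laurent_sum_def
  by (intro sum.cong refl add_char_cong assms(1) cong_sum cong_mult assms(2)) auto

text \<open>Substituting \<open>l t\<close> for \<open>t\<close> permutes the units. A single large
  value therefore recurs along the whole orbit of \<open>a\<close>, which turns a moment into a
  pointwise bound.\<close>

lemma laurent_sum_dilate:
  assumes "prime p" "\<not> p dvd l"
  shows "laurent_sum p J (\<lambda>j. a j * int l ^ unit_exp p j) = laurent_sum p J a"
proof -
  have "laurent_sum p J a
      = (\<Sum>t\<in>{1..<p}. add_char p (\<Sum>j\<in>J. a j * int (l * t mod p) ^ unit_exp p j))"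
    unfolding laurent_sum_def
    by (rule sum.reindex_bij_betw[OF bij_betw_mult_mod_prime[OF assms], symmetric])
  also have "\<dots> = laurent_sum p J (\<lambda>j. a j * int l ^ unit_exp p j)"
    unfolding laurent_sum_def
  proof (intro sum.cong refl add_char_cong cong_sum)
    fix t j
    have "[int (l * t mod p) = int l * int t] (mod int p)"
      by (simp add: cong_def of_nat_mod)
    then have "[a j * int (l * t mod p) ^ unit_exp p j = a j * (int l * int t) ^ unit_exp p j] (mod int p)"
      by (intro cong_mult cong_pow cong_refl)
    then show "[a j * int (l * t mod p) ^ unit_exp p j
        = a j * int l ^ unit_exp p j * int t ^ unit_exp p j] (mod int p)"
      by (simp add: power_mult_distrib mult.assoc)
  qed (use assms prime_gt_0_nat in auto)
  finally show ?thesis ..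
qed

section \<open>Even moments as numbers of solutions of power sum congruences\<close>

definition power_sum :: "nat \<Rightarrow> nat \<Rightarrow> (nat \<Rightarrow> nat) \<Rightarrow> int \<Rightarrow> int" where
  "power_sum p K x j = (\<Sum>i<K. int (x i) ^ unit_exp p j)"

definition unit_tuples :: "nat \<Rightarrow> nat \<Rightarrow> (nat \<Rightarrow> nat) set" where
  "unit_tuples p K = {..<K} \<rightarrow>\<^sub>E {1..<p}"

lemma finite_unit_tuples [simp]: "finite (unit_tuples p K)"
  by (simp add: unit_tuples_def finite_PiE)

lemma laurent_sum_power:
  "laurent_sum p J a ^ K = (\<Sum>x\<in>unit_tuples p K. add_char p (\<Sum>j\<in>J. a j * power_sum p K x j))"
proof -
  have "laurent_sum p J a ^ K
      = (\<Prod>i\<in>{..<K}. \<Sum>t\<in>{1..<p}. add_char p (\<Sum>j\<in>J. a j * int t ^ unit_exp p j))"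
    by (simp add: laurent_sum_def)
  also have "\<dots> = (\<Sum>x\<in>unit_tuples p K. \<Prod>i<K. add_char p (\<Sum>j\<in>J. a j * int (x i) ^ unit_exp p j))"
    unfolding unit_tuples_def by (subst prod_sum_PiE) auto
  also have "\<dots> = (\<Sum>x\<in>unit_tuples p K. add_char p (\<Sum>i<K. \<Sum>j\<in>J. a j * int (x i) ^ unit_exp p j))"
    by (simp only: add_char_sum)
  also have "\<dots> = (\<Sum>x\<in>unit_tuples p K. add_char p (\<Sum>j\<in>J. a j * power_sum p K x j))"
    by (subst sum.swap) (simp add: power_sum_def sum_distrib_left)
  finally show ?thesis .
qed

lemma sum_coeffs_add_char:
  assumes "finite J" "p > 0"
  shows "(\<Sum>a\<in>J \<rightarrow>\<^sub>E {..<p}. add_char p (\<Sum>j\<in>J. int (a j) * h j))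
           = (if \<forall>j\<in>J. int p dvd h j then of_nat p ^ card J else 0)"
proof -
  have "(\<Sum>a\<in>J \<rightarrow>\<^sub>E {..<p}. add_char p (\<Sum>j\<in>J. int (a j) * h j))
      = (\<Prod>j\<in>J. \<Sum>a<p. add_char p (int a * h j))"
    unfolding add_char_sum using assms(1) by (subst prod_sum_PiE) auto
  also have "\<dots> = (\<Prod>j\<in>J. if int p dvd h j then of_nat p else 0)"
    using assms(2) by (simp only: add_char_orthogonality)
  also have "\<dots> = (if \<forall>j\<in>J. int p dvd h j then of_nat p ^ card J else 0)"
    using assms(1) by (auto intro!: prod_zero)
  finally show ?thesis .
qed

definition equal_power_sums :: "nat \<Rightarrow> int set \<Rightarrow> nat \<Rightarrow> ((nat \<Rightarrow> nat) \<times> (nat \<Rightarrow> nat)) set" where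
  "equal_power_sums p J K = {(x, y) \<in> unit_tuples p K \<times> unit_tuples p K.
      \<forall>j\<in>J. [power_sum p K x j = power_sum p K y j] (mod int p)}"

text \<open>The \<open>2 K\<close>-th power is the \<open>K\<close>-th power times its conjugate,
  which expands over pairs of tuples. Summing over each coefficient removes every pair whose power
  sums differ for some exponent.\<close>

lemma laurent_sum_moment:
  assumes "finite J" "p > 0"
  shows "(\<Sum>a\<in>J \<rightarrow>\<^sub>E {..<p}. norm (laurent_sum p J (\<lambda>j. int (a j))) ^ (2 * K))
           = real p ^ card J * real (card (equal_power_sums p J K))"
proof -
  let ?X = "unit_tuples p K"
  have *: "of_real (norm (laurent_sum p J a) ^ (2 * K))
     = (\<Sum>(x, y)\<in>?X \<times> ?X. add_char p (\<Sum>j\<in>J. a j * (power_sum p K x j - power_sum p K y j)))"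
    for a :: "int \<Rightarrow> int"
  proof -
    have "complex_of_real (norm (laurent_sum p J a) ^ (2 * K))
        = laurent_sum p J a ^ K * cnj (laurent_sum p J a ^ K)"
      by (simp only: power_mult of_real_power complex_norm_square[simplified of_real_power] power_mult_distrib complex_cnj_power)
    also have "\<dots> = (\<Sum>x\<in>?X. \<Sum>y\<in>?X. add_char p (\<Sum>j\<in>J. a j * power_sum p K x j)
        * add_char p (- (\<Sum>j\<in>J. a j * power_sum p K y j)))"
      unfolding laurent_sum_power by (simp add: add_char_uminus sum_product)
    also have "\<dots> = (\<Sum>x\<in>?X. \<Sum>y\<in>?X.
        add_char p (\<Sum>j\<in>J. a j * (power_sum p K x j - power_sum p K y j)))"
      unfolding add_char_add[symmetric] by (simp add: right_diff_distrib sum_subtractf)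
    finally show ?thesis by (simp add: sum.cartesian_product)
  qed
  have "complex_of_real (\<Sum>a\<in>J \<rightarrow>\<^sub>E {..<p}. norm (laurent_sum p J (\<lambda>j. int (a j))) ^ (2 * K))
     = (\<Sum>a\<in>J \<rightarrow>\<^sub>E {..<p}. \<Sum>(x, y)\<in>?X \<times> ?X.
          add_char p (\<Sum>j\<in>J. int (a j) * (power_sum p K x j - power_sum p K y j)))"
    by (simp only: of_real_sum *)
  also have "\<dots> = (\<Sum>(x, y)\<in>?X \<times> ?X. \<Sum>a\<in>J \<rightarrow>\<^sub>E {..<p}.
          add_char p (\<Sum>j\<in>J. int (a j) * (power_sum p K x j - power_sum p K y j)))"
    by (subst sum.swap) (simp add: case_prod_unfold)
  also have "\<dots> = (\<Sum>(x, y)\<in>?X \<times> ?X.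
     if \<forall>j\<in>J. int p dvd power_sum p K x j - power_sum p K y j then of_nat p ^ card J else 0)"
    by (simp only: sum_coeffs_add_char[OF assms])
  also have "\<dots> = (\<Sum>z\<in>equal_power_sums p J K. of_nat p ^ card J)"
    unfolding equal_power_sums_def
    by (intro sum.mono_neutral_cong_right) (auto simp: cong_iff_dvd_diff split: if_splits)
  also have "\<dots> = complex_of_real (real p ^ card J * real (card (equal_power_sums p J K)))"
    by simp
  finally show ?thesis by (simp only: of_real_eq_iff)
qed

section \<open>Mordell's bound for Laurent sums modulo a prime\<close>

lemma unit_power_cong:
  assumes "prime p" "\<not> p dvd t" "[int a = j] (mod int (p - 1))"
  shows "[int t ^ unit_exp p j = int t ^ a] (mod int p)"
proof (rule power_cong_exponent[OF assms(1,2)])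
  have "[int (unit_exp p j) = int a] (mod int (p - 1))"
    using cong_trans[OF cong_unit_exp[OF prime_gt_1_nat[OF assms(1)]] cong_sym[OF assms(3)]] .
  then show "[unit_exp p j = a] (mod (p - 1))"
    by (simp only: cong_int_iff)
qed

text \<open>Since \<open>p - 2\<close> is \<open>-1\<close> modulo \<open>p - 1\<close>, the power
  \<open>t^(p-2)\<close> is the inverse of a unit \<open>t\<close>.\<close>

lemma cong_neg_exponent:
  assumes "p > 1"
  shows "[int ((p - 2) * j) = - int j] (mod int (p - 1))"
proof -
  have "int ((p - 2) * j) - (- int j) = int (p - 1) * int j"
    using assms by (cases p; cases "p - 1") (auto simp: algebra_simps of_nat_diff)
  then show ?thesis by (simp add: cong_iff_dvd_diff)
qed

lemma unit_tuples_not_dvd: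
  assumes "x \<in> unit_tuples p K" "i < K"
  shows "\<not> p dvd x i"
proof -
  have "x i \<in> {1..<p}" using assms unfolding unit_tuples_def by blast
  then show ?thesis by (auto dest: dvd_imp_le)
qed

lemma power_sum_cong_pos:
  assumes "prime p" "x \<in> unit_tuples p K"
  shows "[power_sum p K x (int j) = (\<Sum>i<K. int (x i) ^ j)] (mod int p)"
  unfolding power_sum_def
  using assms unit_tuples_not_dvd by (intro cong_sum unit_power_cong) auto

lemma power_sum_cong_neg:
  assumes "prime p" "x \<in> unit_tuples p K"
  shows "[power_sum p K x (- int j) = (\<Sum>i<K. (int (x i) ^ (p - 2)) ^ j)] (mod int p)"
  unfolding power_sum_def power_mult[symmetric]
  using assms unit_tuples_not_dvd prime_gt_1_nat
  by (intro cong_sum unit_power_cong cong_neg_exponent) auto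

text \<open>The exponents \<open>j\<close> and \<open>- j\<close> in \<open>J\<close> and the
  prescribed product supply the hypotheses of \<open>power_sums_determine_tuple\<close>, so all
  members of the fibre take their values among those of one of them. The bound counts maps into
  these at most \<open>K\<close> values.\<close>

lemma card_equal_power_sums_fibre:
  fixes p D :: nat
  defines "K \<equiv> 2 * D + 1" and "J \<equiv> {- int D..int D} - {0}"
  assumes "prime p" "D < p"
  shows "card {x. (x, y) \<in> equal_power_sums p J K \<and> (\<Prod>i<K. x i) mod p = c} \<le> K ^ K"
    (is "card ?F \<le> _")
proof (cases "?F = {}")
  case False
  \<comment> \<open>The reference tuple is a member of the fibre rather than \<open>y\<close>, since
    the product of \<open>y\<close> need not be \<open>c\<close>.\<close>
  then obtain z where z: "(z, y) \<in> equal_power_sums p J K" "(\<Prod>i<K. z i) mod p = c" by auto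
  have "?F \<subseteq> {..<K} \<rightarrow>\<^sub>E z ` {..<K}"
  proof
    fix x assume x: "x \<in> ?F"
    have xX: "x \<in> unit_tuples p K" and zX: "z \<in> unit_tuples p K"
      using x z by (auto simp: equal_power_sums_def)
    have ps: "[power_sum p K x j = power_sum p K z j] (mod int p)" if "j \<in> J" for j
    proof -
      have "[power_sum p K x j = power_sum p K y j] (mod int p)"
        "[power_sum p K z j = power_sum p K y j] (mod int p)"
        using x z that unfolding equal_power_sums_def by auto
      then show ?thesis by (metis cong_sym cong_trans)
    qed
    have inv: "[int (w i) * int (w i) ^ (p - 2) = 1] (mod int p)"
      if "w \<in> unit_tuples p K" "i < K" for w i
    proof -
      have "[int (w i ^ (p - 1)) = int 1] (mod int p)"
        using fermat_theorem[OF assms(3) unit_tuples_not_dvd[OF that]] by (simp only: cong_int_iff)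
      moreover have "p - 1 = Suc (p - 2)" using prime_gt_1_nat[OF assms(3)] by simp
      ultimately show ?thesis by simp
    qed
    have "x i \<in> z ` {..<K}" if "i < K" for i
    proof -
      have "\<exists>l\<in>{..<K}. [int (x i) = int (z l)] (mod int p)"
      proof (rule power_sums_determine_tuple[where D = D and S = "{..<K}" and m = i
            and x = "\<lambda>i. int (x i)" and y = "\<lambda>i. int (z i)" and x' = "\<lambda>i. int (x i) ^ (p - 2)"
            and y' = "\<lambda>i. int (z i) ^ (p - 2)"])
        fix j assume j: "1 \<le> j" "j \<le> D"
        then have J: "int j \<in> J" "- int j \<in> J" by (auto simp: J_def)
        show "[(\<Sum>l<K. int (x l) ^ j) = (\<Sum>l<K. int (z l) ^ j)] (mod int p)"
          using cong_trans[OF cong_sym[OF power_sum_cong_pos[OF assms(3) xX]]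
              cong_trans[OF ps[OF J(1)] power_sum_cong_pos[OF assms(3) zX]]] .
        show "[(\<Sum>l<K. (int (x l) ^ (p - 2)) ^ j) = (\<Sum>l<K. (int (z l) ^ (p - 2)) ^ j)] (mod int p)"
          using cong_trans[OF cong_sym[OF power_sum_cong_neg[OF assms(3) xX]]
              cong_trans[OF ps[OF J(2)] power_sum_cong_neg[OF assms(3) zX]]] .
      next
        have "[(\<Prod>i<K. x i) = (\<Prod>i<K. z i)] (mod p)"
          using x z by (simp add: cong_def)
        then show "[(\<Prod>l<K. int (x l)) = (\<Prod>l<K. int (z l))] (mod int p)"
          by (simp only: cong_int_iff flip: of_nat_prod)
      qed (use assms that inv xX zX in auto)
      then obtain l where l: "l < K" "[x i = z l] (mod p)"
        by (auto simp: cong_int_iff)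
      have "x i \<in> {1..<p}" "z l \<in> {1..<p}"
        using xX zX that l(1) unfolding unit_tuples_def by blast+
      with l have "x i = z l" by (simp add: cong_def)
      with l show ?thesis by blast
    qed
    then show "x \<in> {..<K} \<rightarrow>\<^sub>E z ` {..<K}"
      using xX by (auto simp: unit_tuples_def PiE_iff)
  qed
  then have "card ?F \<le> card ({..<K} \<rightarrow>\<^sub>E z ` {..<K})"
    by (intro card_mono finite_PiE) auto
  also have "\<dots> = card (z ` {..<K}) ^ K" by (simp add: card_PiE)
  also have "\<dots> \<le> K ^ K"
    using card_image_le[of "{..<K}" z] by (intro power_mono) auto
  finally show ?thesis .
next
  case True
  show ?thesis unfolding True by simp
qed

text \<open>The fibres are indexed by \<open>y\<close> and by the residue of the product. The latter
  costs the extra factor \<open>p\<close>, because \<open>2 D\<close> exponents are one condition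
  short of fixing \<open>2 D + 1\<close> variables.\<close>

lemma card_equal_power_sums:
  fixes p D :: nat
  defines "K \<equiv> 2 * D + 1" and "J \<equiv> {- int D..int D} - {0}"
  assumes "prime p" "D < p"
  shows "card (equal_power_sums p J K) \<le> p ^ K * (p * K ^ K)"
proof -
  define F where "F y c = {x. (x, y) \<in> equal_power_sums p J K \<and> (\<Prod>i<K. x i) mod p = c}" for y c
  have fin: "finite (F y c)" for y c
    by (rule finite_subset[of _ "unit_tuples p K"]) (auto simp: F_def equal_power_sums_def)
  have "equal_power_sums p J K \<subseteq> (\<Union>y\<in>unit_tuples p K. \<Union>c<p. (\<lambda>x. (x, y)) ` F y c)"
  proof
    fix v assume v: "v \<in> equal_power_sums p J K"
    obtain x y where xy: "v = (x, y)" by (cases v)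
    have "x \<in> F y ((\<Prod>i<K. x i) mod p)" "y \<in> unit_tuples p K" "(\<Prod>i<K. x i) mod p < p"
      using v prime_gt_0_nat[OF assms(3)] by (auto simp: xy F_def equal_power_sums_def)
    then show "v \<in> (\<Union>y\<in>unit_tuples p K. \<Union>c<p. (\<lambda>x. (x, y)) ` F y c)"
      unfolding xy by blast
  qed
  then have "card (equal_power_sums p J K)
      \<le> card (\<Union>y\<in>unit_tuples p K. \<Union>c<p. (\<lambda>x. (x, y)) ` F y c)"
    using fin by (intro card_mono) auto
  also have "\<dots> \<le> (\<Sum>y\<in>unit_tuples p K. card (\<Union>c<p. (\<lambda>x. (x, y)) ` F y c))"
    by (intro card_UN_le) auto
  also have "\<dots> \<le> (\<Sum>y\<in>unit_tuples p K. \<Sum>c<p. card ((\<lambda>x. (x, y)) ` F y c))"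
    by (intro sum_mono card_UN_le) auto
  also have "\<dots> \<le> (\<Sum>y\<in>unit_tuples p K. \<Sum>c<p. K ^ K)"
  proof (intro sum_mono)
    fix y c
    have "card ((\<lambda>x. (x, y)) ` F y c) \<le> card (F y c)" by (rule card_image_le[OF fin])
    also have "\<dots> \<le> K ^ K"
      unfolding F_def K_def J_def by (rule card_equal_power_sums_fibre[OF assms(3,4)])
    finally show "card ((\<lambda>x. (x, y)) ` F y c) \<le> K ^ K" .
  qed
  also have "\<dots> = card (unit_tuples p K) * (p * K ^ K)" by simp
  also have "\<dots> \<le> p ^ K * (p * K ^ K)"
    by (intro mult_right_mono) (auto simp: unit_tuples_def card_PiE intro: power_mono)
  finally show ?thesis .
qed

text \<open>Two solutions \<open>l\<close> and \<open>m\<close> satisfy \<open>l^j = m^j\<close>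
  modulo \<open>p\<close>, hence the same with \<bar>j\<bar>, and a polynomial of that degree has at
  most \<bar>j\<bar> roots in a field.\<close>

lemma card_dilation_fibre:
  assumes "prime p" "j \<noteq> 0" "\<not> int p dvd a" "\<bar>j\<bar> \<le> int D"
  shows "card {l \<in> {1..<p}. [a * int l ^ unit_exp p j = b] (mod int p)} \<le> D"
    (is "card ?F \<le> _")
proof (cases "?F = {}")
  case False
  then obtain m where m: "m \<in> ?F" by blast
  define n where "n = nat \<bar>j\<bar>"
  have p: "p > 1" using assms(1) by (rule prime_gt_1_nat)
  \<comment> \<open>Raising to the power \<open>c\<close> changes the exponent \<open>j\<close> into
    its absolute value modulo \<open>p - 1\<close>.\<close>
  define c where "c = (if j > 0 then 1 else p - 2)"
  have c: "[int (unit_exp p j * c) = int n] (mod int (p - 1))"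
  proof (cases "j > 0")
    case True
    then show ?thesis using cong_unit_exp[OF p, of j] by (simp add: c_def n_def)
  next
    case False
    have 1: "[int (unit_exp p j * c) = int c * j] (mod int (p - 1))"
      using cong_scalar_left[OF cong_unit_exp[OF p, of j], of "int c"] by (simp add: mult.commute)
    have 2: "[- int ((p - 2) * n) = - (- int n)] (mod int (p - 1))"
      unfolding cong_minus_minus_iff by (rule cong_neg_exponent[OF p])
    have 3: "int c * j = - int ((p - 2) * n)"
      using False by (simp add: c_def n_def)
    show ?thesis
      using cong_trans[OF 1[unfolded 3] 2] unfolding minus_minus .
  qed
  have "?F \<subseteq> {l \<in> {..<p}. [l ^ n = m ^ n] (mod p)}"
  proof
    fix l assume l: "l \<in> ?F"
    have "coprime (int p) a"
      using assms(1,3) by (intro prime_imp_coprime) simp_all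
    then have cop: "coprime a (int p)"
      by (simp only: coprime_commute)
    have lm: "l \<in> {1..<p}" "m \<in> {1..<p}" "[a * int l ^ unit_exp p j = b] (mod int p)"
      "[a * int m ^ unit_exp p j = b] (mod int p)"
      using l m by simp_all
    have "[a * int l ^ unit_exp p j = a * int m ^ unit_exp p j] (mod int p)"
      by (rule cong_trans[OF lm(3) cong_sym[OF lm(4)]])
    then have "[int l ^ unit_exp p j = int m ^ unit_exp p j] (mod int p)"
      using cop by (simp only: cong_mult_lcancel)
    then have lc: "[int l ^ (unit_exp p j * c) = int m ^ (unit_exp p j * c)] (mod int p)"
      unfolding power_mult by (rule cong_pow)
    have tc: "[int t ^ (unit_exp p j * c) = int t ^ n] (mod int p)" if "t \<in> {1..<p}" for t
    proof (rule power_cong_exponent[OF assms(1)])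
      show "\<not> p dvd t" using that by (auto dest: dvd_imp_le)
      show "[unit_exp p j * c = n] (mod (p - 1))" using c by (simp only: cong_int_iff)
    qed
    have "[int l ^ n = int m ^ n] (mod int p)"
      by (rule cong_trans[OF cong_sym[OF tc[OF lm(1)]] cong_trans[OF lc tc[OF lm(2)]]])
    then show "l \<in> {l \<in> {..<p}. [l ^ n = m ^ n] (mod p)}"
      using l by (simp add: cong_int_iff flip: of_nat_power)
  qed
  then have "card ?F \<le> card {l \<in> {..<p}. [l ^ n = m ^ n] (mod p)}"
    by (intro card_mono) auto
  also have "\<dots> \<le> n"
    by (rule roots_mod_prime_bound) (use assms in \<open>auto simp: n_def\<close>)
  finally show ?thesis using assms by (simp add: n_def)
next
  case True
  show ?thesis unfolding True by simp
qed

text \<open>The \<open>p - 1\<close> dilates of \<open>a\<close> all have the same sum. The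
  coordinate \<open>k\<close> alone shows that each vector arises from at most \<open>D\<close> of
  them, so at least \<open>(p - 1) / D\<close> terms of the moment equal the given one.\<close>

lemma laurent_sum_le_moment:
  assumes "prime p" "finite J" "k \<in> J" "k \<noteq> 0" "\<bar>k\<bar> \<le> int D" "\<not> int p dvd a k"
  shows "real (p - 1) * norm (laurent_sum p J a) ^ N
           \<le> real D * (\<Sum>b\<in>J \<rightarrow>\<^sub>E {..<p}. norm (laurent_sum p J (\<lambda>j. int (b j))) ^ N)"
proof -
  have p: "p > 0" using assms(1) by (rule prime_gt_0_nat)
  define g where "g b = norm (laurent_sum p J (\<lambda>j. int (b j))) ^ N" for b
  \<comment> \<open>The dilated vector is reduced modulo \<open>p\<close>, so that it lies in the
    box over which the moment is taken.\<close>
  define \<phi> where "\<phi> l = (\<lambda>j\<in>J. nat (a j * int l ^ unit_exp p j mod int p))" for l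
  have int_\<phi>: "[int (\<phi> l j) = a j * int l ^ unit_exp p j] (mod int p)" if "j \<in> J" for l j
    using p that by (simp add: \<phi>_def cong_def)
  have g\<phi>: "g (\<phi> l) = norm (laurent_sum p J a) ^ N" if "l \<in> {1..<p}" for l
  proof -
    have l: "\<not> p dvd l" using that by (auto dest: dvd_imp_le)
    have "laurent_sum p J (\<lambda>j. int (\<phi> l j)) = laurent_sum p J (\<lambda>j. a j * int l ^ unit_exp p j)"
      by (rule laurent_sum_cong[OF p int_\<phi>])
    also have "\<dots> = laurent_sum p J a"
      by (rule laurent_sum_dilate[OF assms(1) l])
    finally show ?thesis by (simp only: g_def)
  qed
  have "\<phi> l \<in> J \<rightarrow>\<^sub>E {..<p}" for l
    unfolding \<phi>_def using p by (intro restrict_PiE_iff[THEN iffD2]) (simp add: nat_less_iff)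
  then have \<phi>_in: "\<phi> ` {1..<p} \<subseteq> J \<rightarrow>\<^sub>E {..<p}" by blast
  have "real (p - 1) * norm (laurent_sum p J a) ^ N = (\<Sum>l\<in>{1..<p}. g (\<phi> l))"
    using g\<phi> by simp
  also have "\<dots> = (\<Sum>b\<in>\<phi> ` {1..<p}. \<Sum>l | l \<in> {1..<p} \<and> \<phi> l = b. g (\<phi> l))"
    by (rule sum.image_gen) simp
  also have "\<dots> = (\<Sum>b\<in>\<phi> ` {1..<p}. real (card {l \<in> {1..<p}. \<phi> l = b}) * g b)"
    by (intro sum.cong refl) simp
  also have "\<dots> \<le> (\<Sum>b\<in>\<phi> ` {1..<p}. real D * g b)"
  proof (intro sum_mono mult_right_mono)
    fix b assume "b \<in> \<phi> ` {1..<p}"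
    have "card {l \<in> {1..<p}. \<phi> l = b}
        \<le> card {l \<in> {1..<p}. [a k * int l ^ unit_exp p k = int (b k)] (mod int p)}"
      using cong_sym[OF int_\<phi>[OF assms(3)]] by (intro card_mono Collect_mono) (simp_all, fastforce)
    also have "\<dots> \<le> D" by (rule card_dilation_fibre) (use assms in auto)
    finally show "real (card {l \<in> {1..<p}. \<phi> l = b}) \<le> real D" by simp
  qed (simp add: g_def)
  also have "\<dots> \<le> (\<Sum>b\<in>J \<rightarrow>\<^sub>E {..<p}. real D * g b)"
    using \<phi>_in assms(2) by (intro sum_mono2) (auto simp: g_def finite_PiE)
  finally show ?thesis by (simp add: g_def sum_distrib_left)
qed

text \<open>The powers of \<open>p\<close> from the box of coefficients and the count of solutions
  add up to \<open>2 D + K + 1 = 2 K\<close>, the trivial order of magnitude. The gain is the factor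
  \<open>p - 1\<close> on the left.\<close>

lemma mordell_bound:
  fixes p D :: nat
  defines "K \<equiv> 2 * D + 1" and "J \<equiv> {- int D..int D} - {0}"
  assumes "prime p" "D < p" "k \<in> J" "\<not> int p dvd a k"
  shows "real (p - 1) * norm (laurent_sum p J a) ^ (2 * K) \<le> real (D * K ^ K) * real p ^ (2 * K)"
proof -
  have p: "p > 0" using assms(3) by (rule prime_gt_0_nat)
  have fin: "finite J" by (simp add: J_def)
  have cardJ: "card J = 2 * D" by (simp add: J_def card_Diff_singleton)
  have N: "card (equal_power_sums p J K) \<le> p ^ K * (p * K ^ K)"
    unfolding J_def K_def by (rule card_equal_power_sums[OF assms(3,4)])
  have "real (p - 1) * norm (laurent_sum p J a) ^ (2 * K)
      \<le> real D * (\<Sum>b\<in>J \<rightarrow>\<^sub>E {..<p}. norm (laurent_sum p J (\<lambda>j. int (b j))) ^ (2 * K))"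
  proof (rule laurent_sum_le_moment[OF assms(3) fin assms(5)])
    show "k \<noteq> 0" "\<bar>k\<bar> \<le> int D" using assms(5) unfolding J_def by auto
  qed (rule assms(6))
  also have "\<dots> = real D * (real p ^ (2 * D) * real (card (equal_power_sums p J K)))"
    by (simp only: laurent_sum_moment[OF fin p] cardJ)
  also have "\<dots> \<le> real D * (real p ^ (2 * D) * real (p ^ K * (p * K ^ K)))"
    by (intro mult_left_mono of_nat_mono N zero_le_power of_nat_0_le_iff)
  also have "\<dots> = real (D * K ^ K) * real p ^ (2 * K)"
  proof -
    have "real p ^ (2 * K) = real p ^ (2 * D) * (real p ^ K * real p)"
      by (simp add: power_add power_mult_distrib mult_2 K_def)
    then show ?thesis by (simp only: of_nat_mult of_nat_power mult_ac)
  qed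
  finally show ?thesis .
qed

section \<open>Averaging over a one-parameter subgroup\<close>

text \<open>The inverse of a unit is its power \<open>totient q - 1\<close>. The exponent is left
  unreduced so that it follows the sign distinction in \<open>laurent_eval\<close>
  literally.\<close>

definition lift_exp :: "nat \<Rightarrow> int \<Rightarrow> nat" where
  "lift_exp q e = (if e \<ge> 0 then nat e else (totient q - 1) * nat (- e))"

lemma cong_lift_exp:
  assumes "q > 0"
  shows "[int (lift_exp q e) = e] (mod int (totient q))"
proof (cases "e \<ge> 0")
  case False
  have "totient q > 0" using assms by simp
  then have "int (lift_exp q e) = (int (totient q) - 1) * (- e)"
    using False by (simp add: lift_exp_def of_nat_diff Suc_le_eq)
  then have "int (lift_exp q e) - e = int (totient q) * (- e)"
    by (simp add: algebra_simps)
  then show ?thesis by (simp add: cong_iff_dvd_diff)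
qed (simp add: lift_exp_def)

text \<open>The product runs over all of \<open>V\<close>, which gives the monomials a common index
  set; exponent 0 contributes a factor 1.\<close>

definition monomial_value :: "nat \<Rightarrow> nat set \<Rightarrow> (nat \<Rightarrow> int) \<Rightarrow> exponent \<Rightarrow> int" where
  "monomial_value q V x m = (\<Prod>i\<in>V. x i ^ lift_exp q (Poly_Mapping.lookup m i))"

text \<open>Any choice of inverses gives the same class. Euler's choice
  \<open>x i ^ (totient q - 1)\<close> turns the Laurent polynomial into an ordinary one.\<close>

lemma laurent_value_cong_monomials:
  assumes "f \<in> laurent_over V" "finite V" "\<And>i. i \<in> V \<Longrightarrow> coprime (x i) q"
  shows "[laurent_value q x f = (\<Sum>m\<in>Poly_Mapping.keys f.
            Poly_Mapping.lookup f m * monomial_value q V (\<lambda>i. int (x i)) m)] (mod int q)"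
proof -
  define r where "r i = int (x i) ^ (totient q - 1)" for i
  have "[int (x i) * r i = 1] (mod int q)" if "i \<in> V" for i
  proof (cases "q > 0")
    case True
    then have "totient q = Suc (totient q - 1)" by simp
    then have "int (x i) * r i = int (x i ^ totient q)"
      by (metis of_nat_power power_Suc r_def)
    then show ?thesis
      using euler_theorem[OF assms(3)[OF that]] by (metis cong_int_iff of_nat_1)
  next
    \<comment> \<open>For \<open>q = 0\<close>, coprimality forces \<open>x i = 1\<close>.\<close>
    case False
    then show ?thesis using assms(3)[OF that] by (simp add: r_def)
  qed
  then have "[laurent_eval (\<lambda>i. int (x i)) r f = laurent_value q x f] (mod int q)"
    by (rule laurent_value_cong[OF assms(1)])
  moreover have "laurent_eval (\<lambda>i. int (x i)) r f
      = (\<Sum>m\<in>Poly_Mapping.keys f. Poly_Mapping.lookup f m * monomial_value q V (\<lambda>i. int (x i)) m)"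
    unfolding laurent_eval_def
  proof (intro sum.cong refl arg_cong[of _ _ "(*) _"])
    fix m assume m: "m \<in> Poly_Mapping.keys f"
    have "(\<Prod>i\<in>Poly_Mapping.keys m. let e = Poly_Mapping.lookup m i in
            if 0 \<le> e then int (x i) ^ nat e else r i ^ nat (- e))
        = (\<Prod>i\<in>Poly_Mapping.keys m. int (x i) ^ lift_exp q (Poly_Mapping.lookup m i))"
      by (intro prod.cong refl) (simp add: Let_def lift_exp_def r_def power_mult)
    also have "\<dots> = monomial_value q V (\<lambda>i. int (x i)) m"
      unfolding monomial_value_def
      using assms(1,2) m
      by (intro prod.mono_neutral_left) (auto simp: laurent_over_def in_keys_iff lift_exp_def)
    finally show "(\<Prod>i\<in>Poly_Mapping.keys m. let e = Poly_Mapping.lookup m i in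
            if 0 \<le> e then int (x i) ^ nat e else r i ^ nat (- e))
        = monomial_value q V (\<lambda>i. int (x i)) m" .
  qed
  ultimately show ?thesis by (simp only: cong_sym_eq)
qed

text \<open>The fibre of \<open>I_set\<close> over \<open>q\<close>. At \<open>q = 1\<close> it is
  empty unless \<open>V\<close> is, although \<open>totient 1 = 1\<close>; this is why counting by
  totients requires \<open>q > 1\<close>.\<close>

definition unit_funs :: "nat \<Rightarrow> nat set \<Rightarrow> (nat \<Rightarrow> nat) set" where
  "unit_funs q V = V \<rightarrow>\<^sub>E {a. 0 < a \<and> a < q \<and> coprime a q}"

lemma finite_unit_funs: "finite V \<Longrightarrow> finite (unit_funs q V)"
  by (simp add: unit_funs_def finite_PiE)

lemma sum_unit_funs_translate:
  assumes "finite V" "q > 1" "\<And>i. i \<in> V \<Longrightarrow> coprime (u i) q"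
  shows "(\<Sum>x\<in>unit_funs q V. g (\<lambda>i\<in>V. x i * u i mod q)) = (\<Sum>x\<in>unit_funs q V. g x)"
proof -
  let ?\<sigma> = "\<lambda>x. (\<lambda>i\<in>V. x i * u i mod q)"
  have inj: "inj_on ?\<sigma> (unit_funs q V)"
  proof (rule inj_onI)
    fix x y assume xy: "x \<in> unit_funs q V" "y \<in> unit_funs q V" "?\<sigma> x = ?\<sigma> y"
    show "x = y"
    proof (rule PiE_ext[OF xy(1,2)[unfolded unit_funs_def]])
      fix i assume i: "i \<in> V"
      then have "[x i * u i = y i * u i] (mod q)"
        using fun_cong[OF xy(3), of i] by (simp add: cong_def)
      then have "[x i = y i] (mod q)"
        using assms(3)[OF i] by (simp only: cong_mult_rcancel_nat)
      moreover have "x i < q" "y i < q"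
        using xy(1,2) i by (auto simp: unit_funs_def PiE_iff)
      ultimately show "x i = y i" by (simp add: cong_def)
    qed
  qed
  have "?\<sigma> x \<in> unit_funs q V" if "x \<in> unit_funs q V" for x
    unfolding unit_funs_def
  proof (rule restrict_PiE_iff[THEN iffD2], rule ballI)
    fix i assume i: "i \<in> V"
    have c: "coprime (x i * u i mod q) q"
      using that i assms by (auto simp: unit_funs_def PiE_iff)
    moreover have "x i * u i mod q \<noteq> 0"
    proof
      assume "x i * u i mod q = 0"
      with c have "coprime 0 q" by simp
      with assms(2) show False by simp
    qed
    ultimately show "x i * u i mod q \<in> {a. 0 < a \<and> a < q \<and> coprime a q}"
      using assms(2) by simp
  qed
  then have "?\<sigma> ` unit_funs q V = unit_funs q V"
    using inj finite_unit_funs[OF assms(1)] by (intro endo_inj_surj) auto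
  with inj have "bij_betw ?\<sigma> (unit_funs q V) (unit_funs q V)"
    by (simp add: bij_betw_def)
  then show ?thesis by (rule sum.reindex_bij_betw)
qed

text \<open>The exponent of \<open>t\<close> that the monomial acquires when each variable is
  multiplied by \<open>t ^ w i\<close>.\<close>

definition weighted_degree :: "nat set \<Rightarrow> (nat \<Rightarrow> nat) \<Rightarrow> exponent \<Rightarrow> int" where
  "weighted_degree V w m = (\<Sum>i\<in>V. int (w i) * Poly_Mapping.lookup m i)"

lemma monomial_value_dilate:
  "monomial_value q V (\<lambda>i. x i * t ^ w i) m
     = monomial_value q V x m * t ^ (\<Sum>i\<in>V. w i * lift_exp q (Poly_Mapping.lookup m i))"
  by (simp add: monomial_value_def power_mult_distrib prod.distrib power_sum flip: power_mult)

lemma monomial_value_cong: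
  assumes "\<And>i. i \<in> V \<Longrightarrow> [x i = y i] (mod c)"
  shows "[monomial_value q V x m = monomial_value q V y m] (mod c)"
  unfolding monomial_value_def using assms by (intro cong_prod cong_pow)

lemma cong_weighted_degree:
  assumes "q > 0"
  shows "[int (\<Sum>i\<in>V. w i * lift_exp q (Poly_Mapping.lookup m i)) = weighted_degree V w m]
           (mod int (totient q))"
  unfolding weighted_degree_def of_nat_sum of_nat_mult
  using cong_lift_exp[OF assms] by (intro cong_sum cong_mult cong_refl)

text \<open>Partial fractions: the Bezout relation gives \<open>1/(p r) = u/p + v/r\<close>.\<close>

lemma add_char_coprime_split:
  assumes "u * int r + v * int p = 1" "r > 0" "p > 0"
  shows "add_char (p * r) z = add_char p (u * z) * add_char r (v * z)"
proof -
  have "2 * pi * of_int z / of_nat (p * r)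
      = 2 * pi * of_int z * of_int (u * int r + v * int p) / of_nat (p * r)"
    unfolding assms(1) by simp
  also have "\<dots> = 2 * pi * of_int (u * z) / of_nat p + 2 * pi * of_int (v * z) / of_nat r"
    using assms(2,3) by (simp add: field_simps)
  finally show ?thesis by (simp add: add_char_def cis_mult)
qed

text \<open>The coefficient at exponent 0 only contributes a phase. Hence 0 can be left out of
  \<open>J\<close>, as it must be: dilations do not move that coefficient.\<close>

lemma norm_laurent_sum_constant_term:
  assumes "finite J" "0 \<notin> J"
  shows "norm (laurent_sum p (insert 0 J) a) = norm (laurent_sum p J a)"
proof -
  have "laurent_sum p (insert 0 J) a = add_char p (a 0) * laurent_sum p J a"
    using assms by (simp add: laurent_sum_def unit_exp_def add_char_add sum_distrib_left)
  then show ?thesis by (simp add: norm_mult)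
qed

lemma add_char_value_dilate:
  assumes "f \<in> laurent_over V" "finite V" "q > 1" "x \<in> unit_funs q V" "coprime u q"
  shows "add_char q (k * laurent_value q (\<lambda>i\<in>V. x i * (u ^ w i) mod q) f)
           = add_char q (\<Sum>m\<in>Poly_Mapping.keys f. k * Poly_Mapping.lookup f m
               * monomial_value q V (\<lambda>i. int (x i)) m
               * int u ^ (\<Sum>i\<in>V. w i * lift_exp q (Poly_Mapping.lookup m i)))"
proof -
  let ?y = "\<lambda>i\<in>V. x i * (u ^ w i) mod q"
  let ?s = "\<lambda>z. \<Sum>m\<in>Poly_Mapping.keys f. Poly_Mapping.lookup f m * monomial_value q V z m"
  have "[?s (\<lambda>i. int (?y i)) = ?s (\<lambda>i. int (x i) * int u ^ w i)] (mod int q)"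
  proof (intro cong_sum cong_mult cong_refl monomial_value_cong)
    fix i assume "i \<in> V"
    then show "[int (?y i) = int (x i) * int u ^ w i] (mod int q)"
      by (simp add: cong_def zmod_int)
  qed
  moreover have "[laurent_value q ?y f = ?s (\<lambda>i. int (?y i))] (mod int q)"
    using assms by (intro laurent_value_cong_monomials) (auto simp: unit_funs_def PiE_iff)
  ultimately have "[k * laurent_value q ?y f = k * ?s (\<lambda>i. int (x i) * int u ^ w i)] (mod int q)"
    by (intro cong_scalar_left) (rule cong_trans)
  then have "add_char q (k * laurent_value q ?y f) = add_char q (k * ?s (\<lambda>i. int (x i) * int u ^ w i))"
    using assms(3) by (intro add_char_cong) simp_all
  then show ?thesis
    by (simp only: monomial_value_dilate sum_distrib_left mult.assoc)
qed

text \<open>As \<open>p\<close> divides \<open>q\<close>, \<open>p - 1\<close> divides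
  \<open>totient q\<close>, so exponents known modulo \<open>totient q\<close> may be reduced modulo
  \<open>p - 1\<close>. Monomials of equal weighted degree merge and could cancel, which separating
  weights will exclude.\<close>

lemma cong_sum_by_weighted_degree:
  assumes "prime p" "\<not> p dvd t" "q > 0" "p dvd q" "finite J"
    and "\<And>m. m \<in> A \<Longrightarrow> weighted_degree V w m \<in> J" and "finite A"
  shows "[(\<Sum>m\<in>A. b m * int t ^ (\<Sum>i\<in>V. w i * lift_exp q (Poly_Mapping.lookup m i)))
           = (\<Sum>j\<in>J. (\<Sum>m\<in>{m \<in> A. weighted_degree V w m = j}. b m) * int t ^ unit_exp p j)] (mod int p)"
proof -
  have dvd: "p - 1 dvd totient q"
    using totient_dvd[OF assms(4)] by (simp only: totient_prime[OF assms(1)])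
  have "[(\<Sum>m\<in>A. b m * int t ^ (\<Sum>i\<in>V. w i * lift_exp q (Poly_Mapping.lookup m i)))
      = (\<Sum>m\<in>A. b m * int t ^ unit_exp p (weighted_degree V w m))] (mod int p)"
  proof (intro cong_sum cong_mult cong_refl cong_sym[OF unit_power_cong[OF assms(1,2)]])
    fix m
    show "[int (\<Sum>i\<in>V. w i * lift_exp q (Poly_Mapping.lookup m i)) = weighted_degree V w m] (mod int (p - 1))"
      by (rule cong_dvd_modulus[OF cong_weighted_degree[OF assms(3)]]) (use dvd in simp)
  qed
  also have "(\<Sum>m\<in>A. b m * int t ^ unit_exp p (weighted_degree V w m))
      = (\<Sum>j\<in>J. \<Sum>m\<in>{m \<in> A. weighted_degree V w m = j}. b m * int t ^ unit_exp p (weighted_degree V w m))"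
    using assms(5-7) by (intro sum.group[symmetric]) auto
  also have "\<dots> = (\<Sum>j\<in>J. (\<Sum>m\<in>{m \<in> A. weighted_degree V w m = j}. b m) * int t ^ unit_exp p j)"
    by (simp add: sum_distrib_right)
  finally show ?thesis .
qed

text \<open>Only the residue modulo \<open>p\<close> of the dilating factor varies: \<open>\<tau> t\<close> is \<open>t\<close> modulo \<open>p\<close> and
  \<open>1\<close> modulo \<open>r\<close>.\<close>

lemma norm_dilated_sum:
  fixes \<tau> :: "nat \<Rightarrow> nat"
  defines "J D \<equiv> {- int D..int D} - {0}"
  assumes "prime p" "r > 0" "coprime p r" "finite A"
    and \<tau>: "\<And>t. t \<in> {1..<p} \<Longrightarrow> [\<tau> t = t] (mod p)" "\<And>t. t \<in> {1..<p} \<Longrightarrow> [\<tau> t = 1] (mod r)"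
    and deg: "\<And>m. m \<in> A \<Longrightarrow> \<bar>weighted_degree V w m\<bar> \<le> int D"
    and m0: "m0 \<in> A" "weighted_degree V w m0 \<noteq> 0"
      "\<And>m. m \<in> A \<Longrightarrow> weighted_degree V w m = weighted_degree V w m0 \<Longrightarrow> m = m0"
    and b: "\<not> int p dvd b m0"
    and bound: "\<And>a j. j \<in> J D \<Longrightarrow> \<not> int p dvd a j \<Longrightarrow> norm (laurent_sum p (J D) a) \<le> B"
  shows "norm (\<Sum>t\<in>{1..<p}. add_char (p * r) (\<Sum>m\<in>A. b m
             * int (\<tau> t) ^ (\<Sum>i\<in>V. w i * lift_exp (p * r) (Poly_Mapping.lookup m i)))) \<le> B"
proof -
  have p: "p > 0" using assms(2) by (rule prime_gt_0_nat)
  define e where "e m = (\<Sum>i\<in>V. w i * lift_exp (p * r) (Poly_Mapping.lookup m i))" for m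
  have fin: "finite (J D)" "0 \<notin> J D" by (simp_all add: J_def)
  obtain u v where uv: "u * int r + v * int p = 1"
    using bezout_int[of "int r" "int p"] assms(4)
    by (metis coprime_commute coprime_imp_gcd_eq_1 coprime_int_iff)
  \<comment> \<open>The factor \<open>u\<close> comes from the \<open>p\<close>-part of the partial
    fractions. The \<open>r\<close>-part sees only \<open>\<tau> t = 1\<close> and is a phase
    independent of \<open>t\<close>.\<close>
  define a where "a j = (\<Sum>m\<in>{m \<in> A. weighted_degree V w m = j}. u * b m)" for j
  have *: "add_char (p * r) (\<Sum>m\<in>A. b m * int (\<tau> t) ^ e m)
      = add_char r (v * (\<Sum>m\<in>A. b m)) * add_char p (\<Sum>j\<in>insert 0 (J D). a j * int t ^ unit_exp p j)"
    if t: "t \<in> {1..<p}" for t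
  proof -
    have nd: "\<not> p dvd t" using t by (auto dest: dvd_imp_le)
    have 1: "[int (\<tau> t) = int t] (mod int p)" "[int (\<tau> t) = 1] (mod int r)"
      using cong_int_iff[THEN iffD2, OF \<tau>(1)[OF t]] cong_int_iff[THEN iffD2, OF \<tau>(2)[OF t]]
      unfolding of_nat_1 .
    have "[v * (\<Sum>m\<in>A. b m * int (\<tau> t) ^ e m) = v * (\<Sum>m\<in>A. b m * 1 ^ e m)] (mod int r)"
      using 1(2) by (intro cong_mult cong_sum cong_pow cong_refl)
    then have r: "add_char r (v * (\<Sum>m\<in>A. b m * int (\<tau> t) ^ e m)) = add_char r (v * (\<Sum>m\<in>A. b m))"
      unfolding power_one mult_1_right by (rule add_char_cong[OF assms(3)])
    have u1: "[u * (\<Sum>m\<in>A. b m * int (\<tau> t) ^ e m) = u * (\<Sum>m\<in>A. b m * int t ^ e m)] (mod int p)"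
      using 1(1) by (intro cong_mult cong_sum cong_pow cong_refl)
    have u2: "u * (\<Sum>m\<in>A. b m * int t ^ e m) = (\<Sum>m\<in>A. (u * b m) * int t ^ e m)"
      by (simp only: sum_distrib_left mult.assoc)
    have u3: "[(\<Sum>m\<in>A. (u * b m) * int t ^ e m)
        = (\<Sum>j\<in>insert 0 (J D). a j * int t ^ unit_exp p j)] (mod int p)"
      unfolding a_def e_def
    proof (rule cong_sum_by_weighted_degree[OF assms(2) nd])
      fix m assume "m \<in> A"
      then show "weighted_degree V w m \<in> insert 0 (J D)"
        using deg[of m] by (auto simp: J_def)
    qed (use assms(3,5) p fin in auto)
    have "add_char p (u * (\<Sum>m\<in>A. b m * int (\<tau> t) ^ e m))
        = add_char p (\<Sum>j\<in>insert 0 (J D). a j * int t ^ unit_exp p j)"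
      by (rule add_char_cong[OF p cong_trans[OF u1[unfolded u2] u3]])
    then show ?thesis
      unfolding add_char_coprime_split[OF uv assms(3) p] r by (simp only: mult.commute)
  qed
  have "(\<Sum>t\<in>{1..<p}. add_char (p * r) (\<Sum>m\<in>A. b m * int (\<tau> t) ^ e m))
      = add_char r (v * (\<Sum>m\<in>A. b m)) * laurent_sum p (insert 0 (J D)) a"
    unfolding laurent_sum_def sum_distrib_left[of "add_char r (v * (\<Sum>m\<in>A. b m))"]
    by (intro sum.cong refl *)
  then have "norm (\<Sum>t\<in>{1..<p}. add_char (p * r) (\<Sum>m\<in>A. b m * int (\<tau> t) ^ e m))
      = norm (laurent_sum p (J D) a)"
    by (simp only: norm_mult norm_add_char mult_1 norm_laurent_sum_constant_term[OF fin])
  also have "\<dots> \<le> B"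
  proof (rule bound)
    show "weighted_degree V w m0 \<in> J D"
      using deg[OF m0(1)] m0(2) by (auto simp: J_def)
    \<comment> \<open>No other monomial shares the degree of \<open>m0\<close>, so nothing cancels,
      and \<open>u\<close> is a unit modulo \<open>p\<close> by the Bezout relation.\<close>
    have "{m \<in> A. weighted_degree V w m = weighted_degree V w m0} = {m0}"
      using m0 by blast
    then have a0: "a (weighted_degree V w m0) = u * b m0"
      by (simp add: a_def)
    have "\<not> int p dvd u"
    proof
      assume "int p dvd u"
      then have "int p dvd u * int r + v * int p" by simp
      then show False unfolding uv using prime_gt_1_nat[OF assms(2)] by simp
    qed
    then show "\<not> int p dvd a (weighted_degree V w m0)"
      unfolding a0 using b assms(2) by (simp add: prime_dvd_mult_iff)
  qed
  finally show ?thesis unfolding e_def .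
qed

text \<open>Translation by a unit tuple leaves the sum unchanged, so \<open>p - 1\<close> translates
  are added and the order of summation is exchanged. The coefficients of the inner sums vary with
  \<open>x\<close>, hence the demand that \<open>B\<close> be uniform in \<open>a\<close>.\<close>

lemma norm_value_sum_le:
  fixes D :: nat
  defines "J \<equiv> {- int D..int D} - {0}"
  assumes f: "f \<in> laurent_over V" "finite V" and p: "prime p" and r: "r > 0" "coprime p r"
    and deg: "\<And>m. m \<in> Poly_Mapping.keys f \<Longrightarrow> \<bar>weighted_degree V w m\<bar> \<le> int D"
    and m0: "m0 \<in> Poly_Mapping.keys f" "weighted_degree V w m0 \<noteq> 0"
      "\<And>m. m \<in> Poly_Mapping.keys f \<Longrightarrow> weighted_degree V w m = weighted_degree V w m0 \<Longrightarrow> m = m0"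
    and c: "\<not> int p dvd k * Poly_Mapping.lookup f m0"
    and bound: "\<And>a j. j \<in> J \<Longrightarrow> \<not> int p dvd a j \<Longrightarrow> norm (laurent_sum p J a) \<le> B"
  shows "real (p - 1) * norm (\<Sum>x\<in>unit_funs (p * r) V. add_char (p * r) (k * laurent_value (p * r) x f))
           \<le> real (card (unit_funs (p * r) V)) * B"
proof -
  let ?q = "p * r"
  define S where "S = (\<Sum>x\<in>unit_funs ?q V. add_char ?q (k * laurent_value ?q x f))"
  have "\<forall>t. \<exists>s. [s = t] (mod p) \<and> [s = 1] (mod r)"
    using binary_chinese_remainder_nat[OF r(2)] by blast
  then obtain \<tau> where \<tau>: "\<And>t. [\<tau> t = t] (mod p)" "\<And>t. [\<tau> t = 1] (mod r)"
    by metis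
  have q: "?q > 1" using prime_gt_1_nat[OF p] r(1) by (simp add: less_le_trans)
  have cop: "coprime (\<tau> t) ?q" if "t \<in> {1..<p}" for t
  proof -
    have "\<not> p dvd t" using that by (auto dest: dvd_imp_le)
    then have "coprime p t" using prime_imp_coprime[OF p] by blast
    then have "coprime t p" by (simp only: coprime_commute)
    then have "coprime (\<tau> t) p"
      using cong_imp_coprime[OF cong_sym[OF \<tau>(1)]] by blast
    moreover have "coprime (\<tau> t) r"
      using cong_imp_coprime[OF cong_sym[OF \<tau>(2)]] by simp
    ultimately show ?thesis by simp
  qed
  define b where "b x m = k * Poly_Mapping.lookup f m * monomial_value ?q V (\<lambda>i. int (x i)) m" for x m
  define e where "e m = (\<Sum>i\<in>V. w i * lift_exp ?q (Poly_Mapping.lookup m i))" for m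
  have "S = (\<Sum>x\<in>unit_funs ?q V. add_char ?q (\<Sum>m\<in>Poly_Mapping.keys f. b x m * int (\<tau> t) ^ e m))"
    if t: "t \<in> {1..<p}" for t
  proof -
    have "S = (\<Sum>x\<in>unit_funs ?q V. add_char ?q (k * laurent_value ?q (\<lambda>i\<in>V. x i * (\<tau> t ^ w i) mod ?q) f))"
      unfolding S_def using cop[OF t]
      by (intro sum_unit_funs_translate[OF f(2) q, symmetric]) (simp only: coprime_power_left_iff, simp)
    also have "\<dots> = (\<Sum>x\<in>unit_funs ?q V. add_char ?q (\<Sum>m\<in>Poly_Mapping.keys f. b x m * int (\<tau> t) ^ e m))"
      unfolding b_def e_def by (intro sum.cong refl add_char_value_dilate[OF f q _ cop[OF t]])
    finally show ?thesis .
  qed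
  then have "(\<Sum>t\<in>{1..<p}. S)
      = (\<Sum>t\<in>{1..<p}. \<Sum>x\<in>unit_funs ?q V. add_char ?q (\<Sum>m\<in>Poly_Mapping.keys f. b x m * int (\<tau> t) ^ e m))"
    by (rule sum.cong[OF refl])
  then have "of_nat (p - 1) * S
      = (\<Sum>x\<in>unit_funs ?q V. \<Sum>t\<in>{1..<p}. add_char ?q (\<Sum>m\<in>Poly_Mapping.keys f. b x m * int (\<tau> t) ^ e m))"
    by (subst sum.swap) simp
  then have "real (p - 1) * norm S
      = norm (\<Sum>x\<in>unit_funs ?q V. \<Sum>t\<in>{1..<p}. add_char ?q (\<Sum>m\<in>Poly_Mapping.keys f. b x m * int (\<tau> t) ^ e m))"
    by (metis norm_mult norm_of_nat)
  also have "\<dots> \<le> (\<Sum>x\<in>unit_funs ?q V. B)"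
  proof (rule sum_norm_le)
    fix x assume x: "x \<in> unit_funs ?q V"
    \<comment> \<open>Each \<open>x i\<close> is coprime to \<open>q\<close>, hence to its factor
      \<open>p\<close>.\<close>
    have "\<not> int p dvd monomial_value ?q V (\<lambda>i. int (x i)) m0"
    proof
      assume "int p dvd monomial_value ?q V (\<lambda>i. int (x i)) m0"
      then obtain i where i: "i \<in> V" "int p dvd int (x i) ^ lift_exp ?q (Poly_Mapping.lookup m0 i)"
        unfolding monomial_value_def using p f(2) by (subst (asm) prime_dvd_prod_iff) auto
      then have "p dvd x i"
        using prime_dvd_power[OF _ i(2)] p by simp
      moreover have "coprime (x i) p"
        using x i(1) by (auto simp: unit_funs_def PiE_iff)
      ultimately show False
        using p by (metis coprime_absorb_right not_prime_unit)
    qed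
    then have "\<not> int p dvd b x m0"
      unfolding b_def using c p by (simp add: prime_dvd_mult_iff)
    then show "norm (\<Sum>t\<in>{1..<p}. add_char ?q (\<Sum>m\<in>Poly_Mapping.keys f. b x m * int (\<tau> t) ^ e m)) \<le> B"
      unfolding e_def
      by (intro norm_dilated_sum[where D = D and ?m0.0 = m0 and A = "Poly_Mapping.keys f"] p r
          finite_keys \<tau> deg m0 bound[unfolded J_def])
  qed
  finally show ?thesis by (simp add: S_def)
qed

section \<open>Weights, exceptional moduli and totients\<close>

text \<open>With weights \<open>W ^ i\<close> the weighted degree is the value at \<open>W\<close>
  of the nonzero polynomial whose coefficients are the exponents. Finitely many such polynomials
  have finitely many roots, and some natural number \<open>W\<close> avoids them all.\<close>

lemma exists_weights_nonzero_degree: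
  assumes "finite V" "finite T"
    and T: "\<And>m. m \<in> T \<Longrightarrow> m \<noteq> 0" "\<And>m. m \<in> T \<Longrightarrow> Poly_Mapping.keys m \<subseteq> V"
  shows "\<exists>w. \<forall>m\<in>T. weighted_degree V w m \<noteq> 0"
proof -
  define P where "P m = (\<Sum>i\<in>V. Polynomial.monom (Poly_Mapping.lookup m i) i)" for m :: exponent
  have coeff_P: "Polynomial.coeff (P m) i = Poly_Mapping.lookup m i" if "i \<in> V" for m i
    using assms(1) that by (simp add: P_def coeff_sum)
  have "P m \<noteq> 0" if m: "m \<in> T" for m
  proof
    assume "P m = 0"
    then have "Poly_Mapping.lookup m i = 0" if "i \<in> V" for i
      using coeff_P[OF that, of m] by simp
    moreover have "Poly_Mapping.lookup m i = 0" if "i \<notin> V" for i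
      using T(2)[OF m] that by (metis in_keys_iff subsetD)
    ultimately have "m = 0" by (intro poly_mapping_eqI) auto
    with T(1)[OF m] show False by simp
  qed
  then have "finite (\<Union>m\<in>T. {z. poly (P m) z = 0})"
    using assms(2) by (intro finite_UN_I poly_roots_finite)
  moreover have "infinite (range int)"
    by (simp add: finite_image_iff)
  ultimately have "\<not> range int \<subseteq> (\<Union>m\<in>T. {z. poly (P m) z = 0})"
    using finite_subset by blast
  then obtain W where W: "int W \<notin> (\<Union>m\<in>T. {z. poly (P m) z = 0})" by blast
  have "weighted_degree V (\<lambda>i. W ^ i) m = poly (P m) (int W)" for m
    by (simp add: weighted_degree_def P_def poly_sum poly_monom mult.commute)
  with W show ?thesis by (intro exI[of _ "\<lambda>i. W ^ i"]) auto
qed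

text \<open>By linearity of the weighted degree, separation of \<open>m0\<close> from
  \<open>m\<close> is nonvanishing on the difference \<open>m - m0\<close>.\<close>

lemma exists_separating_weights:
  assumes "f \<in> laurent_over V" "finite V" "m0 \<in> Poly_Mapping.keys f" "m0 \<noteq> 0"
  shows "\<exists>w. weighted_degree V w m0 \<noteq> 0 \<and> (\<forall>m\<in>Poly_Mapping.keys f.
            weighted_degree V w m = weighted_degree V w m0 \<longrightarrow> m = m0)"
proof -
  define T where "T = insert m0 ((\<lambda>m. m - m0) ` (Poly_Mapping.keys f - {m0}))"
  have keys: "Poly_Mapping.keys m \<subseteq> V" if "m \<in> Poly_Mapping.keys f" for m
    using assms(1) that by (auto simp: laurent_over_def)
  have "\<exists>w. \<forall>m\<in>T. weighted_degree V w m \<noteq> 0"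
  proof (rule exists_weights_nonzero_degree)
    fix m assume m: "m \<in> T"
    show "m \<noteq> 0" using m assms(4) by (auto simp: T_def)
    show "Poly_Mapping.keys m \<subseteq> V"
      using m keys assms(3) keys_diff by (fastforce simp: T_def)
  qed (use assms in \<open>auto simp: T_def\<close>)
  then obtain w where w: "\<And>m. m \<in> T \<Longrightarrow> weighted_degree V w m \<noteq> 0" by blast
  have "weighted_degree V w (m - m0) = weighted_degree V w m - weighted_degree V w m0" for m
    by (simp add: weighted_degree_def lookup_minus right_diff_distrib sum_subtractf)
  then have "m = m0"
    if "m \<in> Poly_Mapping.keys f" "weighted_degree V w m = weighted_degree V w m0" for m
    using w[of "m - m0"] that by (auto simp: T_def)
  then show ?thesis using w[of m0] by (intro exI[of _ w]) (auto simp: T_def)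
qed

section \<open>Moduli without a large prime factor of multiplicity one\<close>

definition simple_prime_above :: "nat \<Rightarrow> nat \<Rightarrow> bool" where
  "simple_prime_above M q \<longleftrightarrow> (\<exists>p r. prime p \<and> M < p \<and> r > 0 \<and> coprime p r \<and> q = p * r)"

lemma simple_prime_aboveI:
  assumes "prime p" "M < p" "p dvd q" "\<not> p\<^sup>2 dvd q" 
  shows "simple_prime_above M q"
proof -
  obtain r where r: "q = p * r" using assms(3) by blast
  have nd: "\<not> p dvd r" using assms(4) unfolding r power2_eq_square by (simp add: mult_dvd_mono)
  then have "r > 0" by (cases r) auto
  with nd show ?thesis
    unfolding simple_prime_above_def using assms r prime_imp_coprime[OF assms(1) nd] by auto
qed

text \<open>Telescoping, since \<open>1/(n+1)^2\<close> is at most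
  \<open>1/n - 1/(n+1)\<close>.\<close>

lemma sum_inverse_squares_le:
  fixes M N :: nat
  assumes "0 < M"
  shows "(\<Sum>m\<in>{M<..N}. 1 / real m ^ 2) \<le> 1 / real M"
proof (cases "M \<le> N")
  case True
  then have "(\<Sum>m\<in>{M<..N}. 1 / real m ^ 2) \<le> 1 / real M - 1 / real N"
  proof (induction N rule: dec_induct)
    case (step n)
    have n: "real n > 0" using step assms by simp
    have "1 / (real (Suc n))\<^sup>2 \<le> 1 / (real n * real (Suc n))"
      using n by (intro divide_left_mono) (auto simp: power2_eq_square)
    also have "\<dots> = 1 / real n - 1 / real (Suc n)"
      using n by (simp add: field_simps)
    finally have "1 / (real (Suc n))\<^sup>2 \<le> 1 / real n - 1 / real (Suc n)" .
    moreover have "{M<..Suc n} = insert (Suc n) {M<..n}" using step by auto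
    ultimately show ?case using step.IH by simp
  qed simp
  also have "\<dots> \<le> 1 / real M" by simp
  finally show ?thesis .
qed simp

lemma card_multiples_le: "card {q \<in> {1..N}. d dvd q} \<le> N div d" if "d > 0" for d N :: nat
proof -
  have "{q \<in> {1..N}. d dvd q} \<subseteq> (\<lambda>k. d * k) ` {1..N div d}"
  proof
    fix q assume "q \<in> {q \<in> {1..N}. d dvd q}"
    then obtain k where k: "q = d * k" "1 \<le> q" "q \<le> N" by auto
    then have "k \<le> N div d" using that
      by (simp add: less_eq_div_iff_mult_less_eq mult.commute)
    moreover have "k \<ge> 1" using k by (cases k) auto
    ultimately show "q \<in> (\<lambda>k. d * k) ` {1..N div d}" using k by (intro image_eqI[of _ _ k]) auto
  qed
  then have "card {q \<in> {1..N}. d dvd q} \<le> card ((\<lambda>k. d * k) ` {1..N div d})"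
    by (intro card_mono) auto
  also have "\<dots> \<le> N div d" using card_image_le[of "{1..N div d}" "\<lambda>k. d * k"] by simp
  finally show ?thesis .
qed

lemma card_square_multiples_le:
  assumes "0 < M"
  shows "real (card (\<Union>m\<in>{M<..N}. {q \<in> {1..N}. m\<^sup>2 dvd q})) \<le> real N / real M"
proof -
  have "card (\<Union>m\<in>{M<..N}. {q \<in> {1..N}. m\<^sup>2 dvd q}) \<le> (\<Sum>m\<in>{M<..N}. card {q \<in> {1..N}. m\<^sup>2 dvd q})"
    by (rule card_UN_le) simp
  also have "\<dots> \<le> (\<Sum>m\<in>{M<..N}. N div m\<^sup>2)"
    using assms by (intro sum_mono card_multiples_le) auto
  finally have "real (card (\<Union>m\<in>{M<..N}. {q \<in> {1..N}. m\<^sup>2 dvd q})) \<le> (\<Sum>m\<in>{M<..N}. real (N div m\<^sup>2))"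
    by (simp only: of_nat_le_iff flip: of_nat_sum)
  also have "\<dots> \<le> (\<Sum>m\<in>{M<..N}. real N * (1 / real m ^ 2))"
  proof (rule sum_mono)
    fix m show "real (N div m\<^sup>2) \<le> real N * (1 / real m ^ 2)"
      using of_nat_div_le_of_nat[of N "m\<^sup>2", where 'a = real] by simp
  qed
  also have "\<dots> \<le> real N * (1 / real M)"
    unfolding sum_distrib_left[symmetric] by (intro mult_left_mono sum_inverse_squares_le assms) simp
  finally show ?thesis by simp
qed

lemma squarefree_part_eq_prod:
  "squarefree_part n = \<Prod>(prime_factors (squarefree_part n))" for n :: nat
proof -
  have "squarefree_part n = (\<Prod>p\<in>prime_factors (squarefree_part n). p ^ multiplicity p (squarefree_part n))"
    by (rule prime_factorization_nat) (simp add: zero_less_iff_neq_zero)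
  also have "\<dots> = (\<Prod>p\<in>prime_factors (squarefree_part n). p)"
    using squarefree_factorial_semiring'[of "squarefree_part n"]
    by (intro prod.cong refl) simp
  finally show ?thesis .
qed

text \<open>A number is determined by its square part, at most \<open>sqrt N\<close>, and the set of
  primes in its squarefree part. Here this is a subset of \<open>{..M}\<close>, which has
  \<open>Suc M\<close> elements.\<close>

lemma card_smooth_le:
  "real (card {q \<in> {1..N}. \<forall>p. prime p \<longrightarrow> p dvd q \<longrightarrow> p \<le> M}) \<le> 2 ^ Suc M * sqrt (real N)"
    (is "real (card ?B) \<le> _") for M N :: nat
proof -
  let ?h = "\<lambda>q. (square_part q, prime_factors (squarefree_part q))"
  have inj: "inj_on ?h ?B"
  proof (rule inj_onI)
    fix a b :: nat assume h: "?h a = ?h b"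
    then have "\<Prod>(prime_factors (squarefree_part a)) = \<Prod>(prime_factors (squarefree_part b))"
      by (simp only: prod.inject)
    then have sf: "squarefree_part a = squarefree_part b"
      by (simp only: squarefree_part_eq_prod[of a, symmetric] squarefree_part_eq_prod[of b, symmetric])
    have sq: "square_part a = square_part b" using h by (simp only: prod.inject)
    show "a = b" by (rule squarefree_decomposition_unique[OF sq sf])
  qed
  have "?h ` ?B \<subseteq> {1..nat \<lfloor>sqrt (real N)\<rfloor>} \<times> Pow {..M}"
  proof
    fix v assume "v \<in> ?h ` ?B"
    then obtain q where q: "v = ?h q" "q \<in> ?B" by (rule imageE)
    have dvd: "square_part q ^ 2 dvd q" "squarefree_part q dvd q"
      by (rule square_part_square_dvd) (rule dvdI[OF squarefree_decompose])
    have "square_part q ^ 2 \<le> N"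
      using q dvd_imp_le[OF dvd(1)] by simp
    then have "real (square_part q) ^ 2 \<le> real N"
      by (simp only: of_nat_le_iff flip: of_nat_power)
    then have "real (square_part q) \<le> sqrt (real N)" by (rule real_le_rsqrt)
    then have "square_part q \<le> nat \<lfloor>sqrt (real N)\<rfloor>" by (simp add: le_nat_floor)
    moreover have "square_part q \<ge> 1"
      using q square_part_0_iff[of q] by (cases "square_part q") auto
    moreover have "prime_factors (squarefree_part q) \<subseteq> {..M}"
    proof
      fix p assume "p \<in> prime_factors (squarefree_part q)"
      then have "prime p" "p dvd q" using dvd_trans[OF _ dvd(2)] by (auto simp: in_prime_factors_iff)
      then show "p \<in> {..M}" using q(2) by simp
    qed
    ultimately show "v \<in> {1..nat \<lfloor>sqrt (real N)\<rfloor>} \<times> Pow {..M}"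
      unfolding q(1) by simp
  qed
  then have "card ?B \<le> card ({1..nat \<lfloor>sqrt (real N)\<rfloor>} \<times> Pow {..M})"
    by (intro card_inj_on_le[OF inj]) auto
  also have "\<dots> = nat \<lfloor>sqrt (real N)\<rfloor> * 2 ^ Suc M"
    by (simp add: card_cartesian_product card_Pow)
  finally have "real (card ?B) \<le> real (nat \<lfloor>sqrt (real N)\<rfloor> * 2 ^ Suc M)"
    by (simp only: of_nat_le_iff)
  also have "\<dots> = real (nat \<lfloor>sqrt (real N)\<rfloor>) * 2 ^ Suc M" by simp
  also have "\<dots> \<le> sqrt (real N) * 2 ^ Suc M"
    by (intro mult_right_mono of_nat_floor) auto
  finally show ?thesis by (simp only: mult.commute)
qed

text \<open>Such a \<open>q\<close> either has no prime factor above \<open>M\<close> or is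
  divisible by the square of one.\<close>

lemma card_no_simple_prime_above_le:
  assumes "0 < M"
  shows "real (card {q \<in> {1..N}. \<not> simple_prime_above M q})
           \<le> real N / real M + 2 ^ Suc M * sqrt (real N)"
proof -
  let ?A = "\<Union>m\<in>{M<..N}. {q \<in> {1..N}. m\<^sup>2 dvd q}"
  let ?B = "{q \<in> {1..N}. \<forall>p. prime p \<longrightarrow> p dvd q \<longrightarrow> p \<le> M}"
  have "{q \<in> {1..N}. \<not> simple_prime_above M q} \<subseteq> ?A \<union> ?B"
  proof
    fix q assume q: "q \<in> {q \<in> {1..N}. \<not> simple_prime_above M q}"
    show "q \<in> ?A \<union> ?B"
    proof (cases "q \<in> ?B")
      case False
      have q': "q \<in> {1..N}" "\<not> simple_prime_above M q" using q by simp_all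
      have "\<not> (\<forall>p. prime p \<longrightarrow> p dvd q \<longrightarrow> p \<le> M)" using False q'(1) by simp
      then obtain p where p: "prime p" "p dvd q" "M < p" by (auto simp: not_le)
      have "p\<^sup>2 dvd q" using simple_prime_aboveI[OF p(1,3,2)] q'(2) by (rule contrapos_np[rotated])
      moreover have "p \<le> N" using dvd_imp_le[OF p(2)] q'(1) by simp
      ultimately have "q \<in> ?A" using p(3) q'(1) by (intro UN_I[of p]) simp_all
      then show ?thesis by simp
    qed simp
  qed
  then have "card {q \<in> {1..N}. \<not> simple_prime_above M q} \<le> card (?A \<union> ?B)"
    by (intro card_mono) auto
  also have "\<dots> \<le> card ?A + card ?B" by (rule card_Un_le)
  finally have "real (card {q \<in> {1..N}. \<not> simple_prime_above M q}) \<le> real (card ?A) + real (card ?B)"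
    by (simp only: of_nat_le_iff flip: of_nat_add)
  then show ?thesis
    using card_square_multiples_le[OF assms, of N] card_smooth_le[of N M] by linarith
qed

section \<open>Lower bound for the number of tuples\<close>

text \<open>Writing each \<open>n\<close> as the sum of \<open>totient d\<close> over its divisors
  and exchanging sums gives \<open>N (N + 1) / 2\<close> on one side and at most \<open>N\<close>
  times the claimed sum on the other.\<close>

lemma sum_totient_ratio_ge: "real N / 2 \<le> (\<Sum>d\<in>{1..N}. real (totient d) / real d)"
proof (cases "N = 0")
  case False
  have "real N * (real N + 1) / 2 = (\<Sum>n\<in>{1..N}. real n)"
    by (induction N) (auto simp: field_simps)
  also have "\<dots> = (\<Sum>n\<in>{1..N}. \<Sum>d\<in>{d \<in> {1..N}. d dvd n}. real (totient d))"
  proof (intro sum.cong refl)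
    fix n assume n: "n \<in> {1..N}"
    have S: "{d. d dvd n} = {d \<in> {1..N}. d dvd n}"
    proof (intro Collect_cong iffI conjI)
      fix d assume d: "d dvd n"
      then have "d \<le> n" "d > 0" using n dvd_imp_le[OF d] dvd_pos_nat[OF _ d] by simp_all
      then show "d \<in> {1..N}" using n by simp
    qed simp_all
    have "n = (\<Sum>d\<in>{d \<in> {1..N}. d dvd n}. totient d)"
      by (rule totient_divisor_sum[of n, unfolded S, symmetric])
    then show "real n = (\<Sum>d\<in>{d \<in> {1..N}. d dvd n}. real (totient d))"
      by (simp only: of_nat_eq_iff flip: of_nat_sum)
  qed
  also have "\<dots> = (\<Sum>d\<in>{1..N}. \<Sum>n\<in>{n \<in> {1..N}. d dvd n}. real (totient d))"
    by (rule sum.swap_restrict) auto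
  also have "\<dots> = (\<Sum>d\<in>{1..N}. real (card {n \<in> {1..N}. d dvd n}) * real (totient d))"
    by simp
  also have "\<dots> \<le> (\<Sum>d\<in>{1..N}. real N / real d * real (totient d))"
  proof (intro sum_mono mult_right_mono)
    fix d assume "d \<in> {1..N}"
    then have "card {n \<in> {1..N}. d dvd n} \<le> N div d" by (intro card_multiples_le) simp
    then show "real (card {n \<in> {1..N}. d dvd n}) \<le> real N / real d"
      using of_nat_div_le_of_nat[of N d, where 'a = real] by linarith
  qed simp
  also have "\<dots> = real N * (\<Sum>d\<in>{1..N}. real (totient d) / real d)"
    by (simp add: sum_distrib_left)
  finally have "real N * ((real N + 1) / 2) \<le> real N * (\<Sum>d\<in>{1..N}. real (totient d) / real d)"
    by simp
  then show ?thesis using False by (auto simp: mult_le_cancel_left)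
qed simp

text \<open>The ratios average at least 1/2, are at most 1 on the set and below 1/4 off it, so the
  set has density at least 1/4.\<close>

lemma card_large_totient_ge: "real N / 4 \<le> real (card {d \<in> {1..N}. real d / 4 \<le> real (totient d)})"
    (is "_ \<le> real (card ?G)")
proof -
  have "real N / 2 \<le> (\<Sum>d\<in>{1..N}. real (totient d) / real d)" by (rule sum_totient_ratio_ge)
  also have "\<dots> \<le> (\<Sum>d\<in>{1..N}. (if d \<in> ?G then 1 else 0) + 1 / 4)"
  proof (rule sum_mono)
    fix d assume d: "d \<in> {1..N}"
    have 1: "real (totient d) / real d \<le> 1" using totient_le[of d] by (simp add: divide_le_eq)
    show "real (totient d) / real d \<le> (if d \<in> ?G then 1 else 0) + 1 / 4"
    proof (cases "d \<in> ?G")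
      case True
      show ?thesis unfolding if_P[OF True] using 1 by linarith
    next
      case False
      then have "real (totient d) / real d \<le> 1 / 4" using d by (auto simp: field_simps)
      then show ?thesis unfolding if_not_P[OF False] by linarith
    qed
  qed
  also have "\<dots> = real (card ?G) + real N / 4"
    by (simp add: sum.distrib sum.If_cases Int_def conj_commute)
  finally show ?thesis by simp
qed

lemma card_unit_funs:
  assumes "q > 1" "finite V"
  shows "card (unit_funs q V) = totient q ^ card V"
proof -
  have "{a. 0 < a \<and> a < q \<and> coprime a q} = totatives q"
    using assms(1) by (auto simp: totatives_def order_le_less)
  then show ?thesis using assms(2) by (simp add: unit_funs_def card_PiE totient_def)
qed

lemma card_unit_funs_le: "finite V \<Longrightarrow> card (unit_funs q V) \<le> q ^ card V"
proof -
  assume V: "finite V"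
  have "card {a. 0 < a \<and> a < q \<and> coprime a q} \<le> card {..<q}" by (intro card_mono) auto
  then show ?thesis using V by (simp add: unit_funs_def card_PiE power_mono)
qed

text \<open>Of the at least \<open>N/4\<close> numbers with \<open>totient d \<ge> d/4\<close>, at
  most \<open>N/8\<close> are not above \<open>N/8\<close>. The others number at least
  \<open>N/8\<close> and have totient at least \<open>N/32\<close>. The bound
  \<open>N \<ge> 8\<close> ensures that they exceed 1.\<close>

lemma sum_card_unit_funs_ge:
  assumes "finite V" "N \<ge> 8"
  shows "real N / 8 * (real N / 32) ^ card V \<le> (\<Sum>q\<in>{1..N}. real (card (unit_funs q V)))"
proof -
  define G where "G = {d \<in> {1..N}. real d / 4 \<le> real (totient d)}"
  define H where "H = {d \<in> G. real N / 8 < real d}"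
  have fin: "finite G" by (simp add: G_def)
  have "G - H \<subseteq> {1..nat \<lfloor>real N / 8\<rfloor>}"
  proof
    fix d assume "d \<in> G - H"
    then have d: "d \<in> {1..N}" "real d \<le> real N / 8" by (auto simp: G_def H_def)
    then have "d \<le> nat \<lfloor>real N / 8\<rfloor>" by (intro le_nat_floor)
    then show "d \<in> {1..nat \<lfloor>real N / 8\<rfloor>}" using d(1) by simp
  qed
  then have "card (G - H) \<le> nat \<lfloor>real N / 8\<rfloor>"
    using card_mono[of "{1..nat \<lfloor>real N / 8\<rfloor>}" "G - H"] by simp
  then have "real (card (G - H)) \<le> real (nat \<lfloor>real N / 8\<rfloor>)"
    by (simp only: of_nat_le_iff)
  also have "\<dots> \<le> real N / 8" by (intro of_nat_floor) simp
  finally have GH: "real (card (G - H)) \<le> real N / 8" .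
  have "G = H \<union> (G - H)" by (auto simp: H_def)
  then have "card G \<le> card H + card (G - H)" using card_Un_le[of H "G - H"] by simp
  then have "real (card G) \<le> real (card H) + real (card (G - H))" by linarith
  then have cardH: "real N / 8 \<le> real (card H)"
    using GH card_large_totient_ge[of N] by (simp add: G_def)
  have "real N / 8 * (real N / 32) ^ card V \<le> real (card H) * (real N / 32) ^ card V"
    using cardH by (intro mult_right_mono) auto
  also have "\<dots> = (\<Sum>q\<in>H. (real N / 32) ^ card V)" by simp
  also have "\<dots> \<le> (\<Sum>q\<in>H. real (card (unit_funs q V)))"
  proof (rule sum_mono)
    fix q assume q: "q \<in> H"
    then have "q > 1" using assms(2) by (auto simp: H_def)
    moreover have "real N / 32 \<le> real (totient q)"
      using q by (auto simp: H_def G_def)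
    ultimately show "(real N / 32) ^ card V \<le> real (card (unit_funs q V))"
      using assms(1) by (simp add: card_unit_funs power_mono)
  qed
  also have "\<dots> \<le> (\<Sum>q\<in>{1..N}. real (card (unit_funs q V)))"
    by (intro sum_mono2) (auto simp: H_def G_def)
  finally show ?thesis .
qed

section \<open>Weyl's criterion\<close>

inductive trig_poly :: "(complex \<Rightarrow> complex) \<Rightarrow> bool" where
  monomial: "trig_poly (\<lambda>z. c * z powi k)"
| add: "trig_poly f \<Longrightarrow> trig_poly g \<Longrightarrow> trig_poly (\<lambda>z. f z + g z)"

text \<open>Agreement is asked only on the unit circle because the law
  \<open>z^k z^l = z^(k+l)\<close> can fail at 0, and conjugation equals inversion only
  there.\<close>

definition trig_on_circle :: "(complex \<Rightarrow> complex) \<Rightarrow> bool" where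
  "trig_on_circle f \<longleftrightarrow> (\<exists>g. trig_poly g \<and> (\<forall>z. norm z = 1 \<longrightarrow> f z = g z))"

lemma trig_on_circleI: "trig_poly g \<Longrightarrow> (\<And>z. norm z = 1 \<Longrightarrow> f z = g z) \<Longrightarrow> trig_on_circle f"
  by (auto simp: trig_on_circle_def)

lemma trig_on_circle_add:
  assumes "trig_on_circle f" "trig_on_circle g"
  shows "trig_on_circle (\<lambda>z. f z + g z)"
proof -
  obtain f' g' where "trig_poly f'" "trig_poly g'" "\<forall>z. norm z = 1 \<longrightarrow> f z = f' z" "\<forall>z. norm z = 1 \<longrightarrow> g z = g' z"
    using assms by (auto simp: trig_on_circle_def)
  then show ?thesis
    by (intro trig_on_circleI[of "\<lambda>z. f' z + g' z"] trig_poly.add) auto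
qed

lemma trig_poly_mult_monomial:
  "trig_poly g \<Longrightarrow> trig_on_circle (\<lambda>z. c * z powi k * g z)"
proof (induction rule: trig_poly.induct)
  case (monomial d l)
  show ?case
  proof (rule trig_on_circleI[OF trig_poly.monomial[of "c * d" "k + l"]])
    fix z :: complex assume "norm z = 1"
    then have "z \<noteq> 0" by auto
    then show "c * z powi k * (d * z powi l) = c * d * z powi (k + l)"
      by (simp add: power_int_add)
  qed
next
  case (add g h)
  from trig_on_circle_add[OF add.IH] show ?case by (simp add: algebra_simps)
qed

lemma trig_poly_mult:
  "trig_poly f \<Longrightarrow> trig_poly g \<Longrightarrow> trig_on_circle (\<lambda>z. f z * g z)"
proof (induction rule: trig_poly.induct)
  case (monomial c k)
  then show ?case by (rule trig_poly_mult_monomial)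
next
  case (add f h)
  from trig_on_circle_add[OF add.IH(1)[OF add.prems] add.IH(2)[OF add.prems]]
  show ?case by (simp add: algebra_simps)
qed

lemma trig_on_circle_mult:
  assumes "trig_on_circle f" "trig_on_circle g"
  shows "trig_on_circle (\<lambda>z. f z * g z)"
proof -
  obtain f' g' where 1: "trig_poly f'" "trig_poly g'" "\<forall>z. norm z = 1 \<longrightarrow> f z = f' z" "\<forall>z. norm z = 1 \<longrightarrow> g z = g' z"
    using assms by (auto simp: trig_on_circle_def)
  obtain h where "trig_poly h" "\<forall>z. norm z = 1 \<longrightarrow> f' z * g' z = h z"
    using trig_poly_mult[OF 1(1,2)] by (auto simp: trig_on_circle_def)
  with 1 show ?thesis by (intro trig_on_circleI[of h]) auto
qed

text \<open>A real linear function is a combination of \<open>z\<close> and its conjugate, which on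
  the circle is \<open>z^(-1)\<close>.\<close>

lemma trig_on_circle_linear:
  fixes f :: "complex \<Rightarrow> real"
  assumes "bounded_linear f"
  shows "trig_on_circle (\<lambda>z. of_real (f z))"
proof -
  define a b :: complex where "a = of_real (f 1)" and "b = of_real (f \<i>)"
  have "trig_poly (\<lambda>z. (a - \<i> * b) / 2 * z powi 1 + (a + \<i> * b) / 2 * z powi (-1))"
    by (intro trig_poly.intros)
  then show ?thesis
  proof (rule trig_on_circleI)
    fix z :: complex assume z: "norm z = 1"
    have "f z = f (Re z *\<^sub>R 1 + Im z *\<^sub>R \<i>)"
      by (rule arg_cong[of _ _ f]) (simp add: complex_eq_iff)
    also have "\<dots> = Re z * f 1 + Im z * f \<i>"
      using assms by (simp only: linear_simps real_scaleR_def)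
    finally have f: "of_real (f z) = of_real (Re z) * a + of_real (Im z) * b"
      by (simp add: a_def b_def)
    have inv: "inverse z = cnj z"
      using z complex_norm_square[of z] by (intro inverse_unique) simp
    have zi: "z powi (-1) = cnj z" by (simp add: power_int_minus inv)
    have ri: "of_real (Re z) = (z + cnj z) / 2" "of_real (Im z) = - \<i> * (z - cnj z) / 2"
      by (simp_all add: complex_eq_iff)
    show "of_real (f z) = (a - \<i> * b) / 2 * z powi 1 + (a + \<i> * b) / 2 * z powi (-1)"
      unfolding f zi ri power_int_1_right by (simp add: field_simps)
  qed
qed

lemma trig_on_circle_real_polynomial_function:
  "real_polynomial_function g \<Longrightarrow> trig_on_circle (\<lambda>z. of_real (g z))"
proof (induction rule: real_polynomial_function.induct)
  case (linear f)
  then show ?case by (rule trig_on_circle_linear)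
next
  case (const c)
  show ?case by (rule trig_on_circleI[OF trig_poly.monomial[of "of_real c" 0]]) simp
next
  case (add f g)
  then show ?case using trig_on_circle_add by simp
next
  case (mult f g)
  then show ?case using trig_on_circle_mult by simp
qed

lemma cis_power_int_2pi: "cis (2 * pi * t) powi k = cis (2 * pi * of_int k * t)"
  by (simp add: cis_power_int mult_ac)

lemma has_integral_cis_period:
  assumes "k \<noteq> 0"
  shows "((\<lambda>t. cis (2 * pi * of_int k * t)) has_integral 0) {0..1}"
proof -
  define c where "c = 2 * pi * of_int k"
  have c: "c \<noteq> 0" using assms by (simp add: c_def)
  have "((\<lambda>t. cis (c * t)) has_integral (cis (c * 1) / (\<i> * of_real c) - cis (c * 0) / (\<i> * of_real c))) {0..1}"
  proof (rule fundamental_theorem_of_calculus)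
    fix t :: real
    show "((\<lambda>t. cis (c * t) / (\<i> * of_real c)) has_vector_derivative cis (c * t)) (at t within {0..1})"
      unfolding cis_conv_exp using c
      by (auto intro!: derivative_eq_intros has_vector_derivative_real_field simp: field_simps)
  qed simp
  moreover have "cis (c * 1) = 1" by (simp add: c_def cis_multiple_2pi)
  ultimately show ?thesis by (simp add: c_def)
qed

lemma continuous_on_trig_poly:
  "trig_poly g \<Longrightarrow> continuous_on {0..1} (\<lambda>t. g (cis (2 * pi * t)))"
  by (induction rule: trig_poly.induct) (auto simp: cis_power_int_2pi intro!: continuous_intros)

section \<open>Equidistribution from vanishing exponential means\<close>

locale weyl_means =
  fixes A :: "'b \<Rightarrow> 'a set" and u :: "'a \<Rightarrow> real" and F :: "'b filter"
  assumes finite_A: "\<And>x. finite (A x)"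
    and nonempty_A: "\<forall>\<^sub>F x in F. A x \<noteq> {}"
    and exp_means: "\<And>k::int. k \<noteq> 0 \<Longrightarrow>
      ((\<lambda>x. (\<Sum>t\<in>A x. cis (2 * pi * of_int k * u t)) / of_nat (card (A x))) \<longlongrightarrow> 0) F"
begin

text \<open>Monomials with nonzero exponent have limiting mean 0 and integral 0; constants agree
  once \<open>A x\<close> is nonempty.\<close>

lemma tendsto_mean_trig_poly:
  "trig_poly g \<Longrightarrow> ((\<lambda>x. (\<Sum>t\<in>A x. g (cis (2 * pi * u t))) / of_nat (card (A x)))
      \<longlongrightarrow> integral {0..1} (\<lambda>t. g (cis (2 * pi * t)))) F"
proof (induction rule: trig_poly.induct)
  case (monomial c k)
  show ?case
  proof (cases "k = 0")
    case True
    have "\<forall>\<^sub>F x in F. (\<Sum>t\<in>A x. c * cis (2 * pi * u t) powi k) / of_nat (card (A x)) = c"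
      using nonempty_A by eventually_elim (use finite_A True in auto)
    then show ?thesis using True by (simp add: tendsto_eventually)
  next
    case False
    have "integral {0..1} (\<lambda>t. cis (2 * pi * of_int k * t)) = 0"
      by (rule integral_unique[OF has_integral_cis_period[OF False]])
    moreover have "((\<lambda>x. c * ((\<Sum>t\<in>A x. cis (2 * pi * of_int k * u t)) / of_nat (card (A x)))) \<longlongrightarrow> c * 0) F"
      by (intro tendsto_mult tendsto_const exp_means False)
    ultimately show ?thesis
      by (simp add: cis_power_int_2pi sum_distrib_left)
  qed
next
  case (add f g)
  have "integral {0..1} (\<lambda>t. f (cis (2 * pi * t)) + g (cis (2 * pi * t)))
     = integral {0..1} (\<lambda>t. f (cis (2 * pi * t))) + integral {0..1} (\<lambda>t. g (cis (2 * pi * t)))"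
    using add.hyps by (intro integral_add integrable_continuous_real continuous_on_trig_poly)
  with tendsto_add[OF add.IH] show ?case
    by (simp add: sum.distrib add_divide_distrib)
qed

lemma tendsto_mean_real_polynomial_function:
  assumes "real_polynomial_function g"
  shows "((\<lambda>x. (\<Sum>t\<in>A x. g (cis (2 * pi * u t))) / real (card (A x)))
      \<longlongrightarrow> integral {0..1} (\<lambda>t. g (cis (2 * pi * t)))) F"
proof -
  obtain h where h: "trig_poly h" "\<And>z. norm z = 1 \<Longrightarrow> of_real (g z) = h z"
    using trig_on_circle_real_polynomial_function[OF assms] by (auto simp: trig_on_circle_def)
  have gh: "h (cis s) = of_real (g (cis s))" for s
    by (simp add: h(2))
  have "continuous_on {0..1} (\<lambda>t. Re (h (cis (2 * pi * t))))"
    by (intro continuous_on_Re continuous_on_trig_poly h)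
  then have "(\<lambda>t. g (cis (2 * pi * t))) integrable_on {0..1}"
    unfolding gh by (simp add: integrable_continuous_real)
  then have int: "integral {0..1} (\<lambda>t. of_real (g (cis (2 * pi * t))))
      = complex_of_real (integral {0..1} (\<lambda>t. g (cis (2 * pi * t))))"
    using integral_linear[OF _ bounded_linear_of_real] by (simp add: o_def)
  have "((\<lambda>x. complex_of_real ((\<Sum>t\<in>A x. g (cis (2 * pi * u t))) / real (card (A x))))
      \<longlongrightarrow> complex_of_real (integral {0..1} (\<lambda>t. g (cis (2 * pi * t))))) F"
    using tendsto_mean_trig_poly[OF h(1)] unfolding gh int by simp
  then show ?thesis by (simp only: tendsto_of_real_iff)
qed

text \<open>Stone-Weierstrass approximation within \<open>e / 3\<close>, carried out on the circle
  so that periodicity is built in.\<close>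

lemma tendsto_mean_continuous:
  fixes h :: "complex \<Rightarrow> real"
  assumes h: "continuous_on (sphere 0 1) h"
  shows "((\<lambda>x. (\<Sum>t\<in>A x. h (cis (2 * pi * u t))) / real (card (A x)))
      \<longlongrightarrow> integral {0..1} (\<lambda>t. h (cis (2 * pi * t)))) F"
proof (rule tendstoI)
  fix e :: real assume "e > 0"
  then have e3: "e / 3 > 0" by simp
  obtain g where g: "real_polynomial_function g" "\<And>z. z \<in> sphere 0 1 \<Longrightarrow> \<bar>h z - g z\<bar> < e / 3"
    using Stone_Weierstrass_real_polynomial_function[OF compact_sphere h e3] by blast
  let ?m = "\<lambda>f x. (\<Sum>t\<in>A x. f (cis (2 * pi * u t))) / real (card (A x))"
  let ?I = "\<lambda>f. integral {0..1} (\<lambda>t. f (cis (2 * pi * t)) :: real)"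
  have hg: "\<bar>h (cis s) - g (cis s)\<bar> < e / 3" for s
    by (rule g(2)) simp
  have int: "(\<lambda>t. f (cis (2 * pi * t))) integrable_on {0..1}" if "continuous_on (sphere 0 1) f"
    for f :: "complex \<Rightarrow> real"
  proof (rule integrable_continuous_real)
    have "continuous_on {0..1::real} (\<lambda>t. cis (2 * pi * t))" by (intro continuous_intros)
    then show "continuous_on {0..1} (\<lambda>t. f (cis (2 * pi * t)))"
      by (rule continuous_on_compose2[OF that]) auto
  qed
  have gc: "continuous_on (sphere 0 1) g"
    using g(1) by (simp add: continuous_on_polymonial_function real_polynomial_function_eq)
  have "\<bar>?I h - ?I g\<bar> \<le> e / 3"
  proof -
    have "?I h - ?I g = integral {0..1} (\<lambda>t. h (cis (2 * pi * t)) - g (cis (2 * pi * t)))"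
      by (intro integral_diff[symmetric] int h gc)
    also have "norm \<dots> \<le> integral {0..1::real} (\<lambda>t. e / 3 :: real)"
    proof (rule integral_norm_bound_integral)
      fix t show "norm (h (cis (2 * pi * t)) - g (cis (2 * pi * t))) \<le> e / 3"
        using hg[of "2 * pi * t"] by simp
    qed (intro integrable_diff int h gc integrable_const_ivl)+
    finally show ?thesis by (simp add: real_norm_def)
  qed
  moreover have "\<bar>?m h x - ?m g x\<bar> \<le> e / 3" for x
  \<comment> \<open>Over an empty set both means are 0, so the estimate holds for every
    \<open>x\<close>.\<close>
  proof (cases "A x = {}")
    case False
    then have c: "real (card (A x)) > 0" using finite_A by (simp add: card_gt_0_iff)
    have "\<bar>\<Sum>t\<in>A x. h (cis (2 * pi * u t)) - g (cis (2 * pi * u t))\<bar> \<le> (\<Sum>t\<in>A x. e / 3)"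
      using hg by (intro order_trans[OF sum_abs] sum_mono less_imp_le)
    then have "\<bar>(\<Sum>t\<in>A x. h (cis (2 * pi * u t)) - g (cis (2 * pi * u t))) / real (card (A x))\<bar> \<le> e / 3"
      using c by (simp add: abs_divide divide_le_eq mult.commute)
    then show ?thesis by (simp add: sum_subtractf diff_divide_distrib)
  qed (use e3 in simp)
  moreover have "\<forall>\<^sub>F x in F. dist (?m g x) (?I g) < e / 3"
    using tendstoD[OF tendsto_mean_real_polynomial_function[OF g(1)] e3] .
  ultimately show "\<forall>\<^sub>F x in F. dist (?m h x) (?I h) < e"
  proof -
    assume I: "\<bar>?I h - ?I g\<bar> \<le> e / 3" and m: "\<And>x. \<bar>?m h x - ?m g x\<bar> \<le> e / 3"
      and ev: "\<forall>\<^sub>F x in F. dist (?m g x) (?I g) < e / 3"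
    show ?thesis
      using ev
    proof (rule eventually_mono)
      fix x assume "dist (?m g x) (?I g) < e / 3"
      then show "dist (?m h x) (?I h) < e"
        using I m[of x] unfolding dist_real_def by linarith
    qed
  qed
qed

text \<open>The indicator of a closed set is the pointwise limit from above of the continuous
  functions \<open>h m\<close>, and dominated convergence brings their integrals to
  \<open>L\<close>. An upper bound is enough, as lower bounds will come from complements.\<close>

lemma eventually_proportion_closed_le:
  fixes K :: "real set"
  assumes K: "compact K" "K \<noteq> {}" "K \<subseteq> {0..1}"
    and L: "((\<lambda>t. if t \<in> K then 1 else 0) has_integral L) {0..1}" and "e > 0"
  shows "\<forall>\<^sub>F x in F. real (card {t \<in> A x. u t \<in> K}) / real (card (A x)) \<le> L + e"
proof -
  define C where "C = (\<lambda>s. cis (2 * pi * s)) ` K"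
  define h where "h m z = max 0 (1 - real m * infdist z C)" for m z
  have "continuous_on K (\<lambda>s. cis (2 * pi * s))" by (intro continuous_intros)
  then have C: "closed C" "C \<noteq> {}"
    using K by (auto simp: C_def intro!: compact_imp_closed compact_continuous_image)
  have cont: "continuous_on (sphere 0 1) (h m)" for m
    unfolding h_def by (intro continuous_intros)
  let ?g = "\<lambda>t. if cis (2 * pi * t) \<in> C then 1 else 0 :: real"
  \<comment> \<open>The circle glues 0 and 1, so lying in \<open>C\<close> and lying in
    \<open>K\<close> may differ at these two points, which do not affect the integral.\<close>
  have "(?g has_integral L) {0..1}"
  proof (rule has_integral_spike_finite[OF _ _ L])
    fix t :: real assume t: "t \<in> {0..1} - {0, 1}"
    have "cis (2 * pi * t) \<in> C \<longleftrightarrow> t \<in> K"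
    proof
      assume "cis (2 * pi * t) \<in> C"
      then obtain s where s: "s \<in> K" "cis (2 * pi * t) = cis (2 * pi * s)" by (auto simp: C_def)
      have "cis (2 * pi * (t - s)) = 1"
        using s(2) by (simp add: right_diff_distrib flip: cis_divide)
      then have "cos (2 * pi * (t - s)) = 1" by (simp add: complex_eq_iff)
      then obtain n :: int where "2 * pi * (t - s) = of_int n * 2 * pi"
        by (auto simp: cos_one_2pi_int)
      then have n: "t - s = of_int n" by simp
      then have "\<bar>of_int n :: real\<bar> < 1" using t s(1) K(3) by auto
      then have "n = 0" by linarith
      then show "t \<in> K" using n s(1) by simp
    qed (auto simp: C_def)
    then show "?g t = (if t \<in> K then 1 else 0)" by simp
  qed simp
  then have gL: "integral {0..1} ?g = L" by (rule integral_unique)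
  have "(\<lambda>m. integral {0..1} (\<lambda>t. h m (cis (2 * pi * t)))) \<longlonglongrightarrow> integral {0..1} ?g"
  proof (rule dominated_convergence(2))
    fix m
    have "continuous_on {0..1::real} (\<lambda>t. cis (2 * pi * t))" by (intro continuous_intros)
    then have "continuous_on {0..1} (\<lambda>t. h m (cis (2 * pi * t)))"
      by (rule continuous_on_compose2[OF cont]) auto
    then show "(\<lambda>t. h m (cis (2 * pi * t))) integrable_on {0..1}"
      by (rule integrable_continuous_real)
  next
    show "(\<lambda>t. 1 :: real) integrable_on {0..1::real}" by (rule integrable_const_ivl)
  next
    fix m and t :: real
    show "norm (h m (cis (2 * pi * t))) \<le> 1"
      using infdist_nonneg[of "cis (2 * pi * t)" C] by (auto simp: h_def)
  next
    fix t :: real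
    show "(\<lambda>m. h m (cis (2 * pi * t))) \<longlonglongrightarrow> ?g t"
    proof (cases "cis (2 * pi * t) \<in> C")
      case True
      then show ?thesis by (simp add: h_def)
    next
      case False
      define d where "d = infdist (cis (2 * pi * t)) C"
      have d: "d > 0"
        using False in_closed_iff_infdist_zero[OF C] infdist_nonneg[of "cis (2 * pi * t)" C]
        by (simp add: d_def order_le_less)
      have "\<forall>\<^sub>F m in sequentially. h m (cis (2 * pi * t)) = 0"
      proof (rule eventually_sequentiallyI)
        fix m assume "m \<ge> nat \<lceil>1 / d\<rceil>"
        then have "1 / d \<le> real m" by linarith
        then have "1 \<le> real m * d" using d by (simp add: divide_le_eq)
        then show "h m (cis (2 * pi * t)) = 0" by (simp add: h_def d_def)
      qed
      then show ?thesis using False by (simp add: tendsto_eventually)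
    qed
  qed
  then have "\<forall>\<^sub>F m in sequentially. integral {0..1} (\<lambda>t. h m (cis (2 * pi * t))) < L + e"
    unfolding gL using \<open>e > 0\<close> by (intro order_tendstoD(2)) auto
  then obtain m where m: "integral {0..1} (\<lambda>t. h m (cis (2 * pi * t))) < L + e"
    using eventually_happens'[OF sequentially_bot] by blast
  have "\<forall>\<^sub>F x in F. (\<Sum>t\<in>A x. h m (cis (2 * pi * u t))) / real (card (A x)) < L + e"
    by (rule order_tendstoD(2)[OF tendsto_mean_continuous[OF cont] m])
  then show ?thesis
  proof (rule eventually_mono)
    fix x assume x: "(\<Sum>t\<in>A x. h m (cis (2 * pi * u t))) / real (card (A x)) < L + e"
    have "real (card {t \<in> A x. u t \<in> K}) = (\<Sum>t\<in>{t \<in> A x. u t \<in> K}. h m (cis (2 * pi * u t)))"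
      by (simp add: h_def C_def)
    also have "\<dots> \<le> (\<Sum>t\<in>A x. h m (cis (2 * pi * u t)))"
      using finite_A by (intro sum_mono2) (auto simp: h_def)
    finally have "real (card {t \<in> A x. u t \<in> K}) / real (card (A x))
        \<le> (\<Sum>t\<in>A x. h m (cis (2 * pi * u t))) / real (card (A x))"
      by (intro divide_right_mono) auto
    with x show "real (card {t \<in> A x. u t \<in> K}) / real (card (A x)) \<le> L + e" by linarith
  qed
qed

text \<open>The half-open interval lies in \<open>{a..b}\<close>, and its complement in
  \<open>[0,1)\<close> lies in \<open>{0..a} \<union> {b..1}\<close>. Both are closed with lengths
  adding up to 1, so the two upper bounds enclose the proportion.\<close>

lemma weyl_criterion:
  assumes u: "\<And>x t. t \<in> A x \<Longrightarrow> 0 \<le> u t \<and> u t < 1" and ab: "0 \<le> a" "a \<le> b" "b \<le> 1"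
  shows "((\<lambda>x. real (card {t \<in> A x. u t \<in> {a..<b}}) / real (card (A x))) \<longlongrightarrow> b - a) F"
proof (rule tendstoI)
  fix e :: real assume "e > 0"
  then have e2: "e / 2 > 0" by simp
  let ?r = "\<lambda>P x. real (card {t \<in> A x. P (u t)}) / real (card (A x))"
  have L1: "((\<lambda>t. if t \<in> {a..b} then 1 else 0) has_integral b - a) {0..1}"
    using has_integral_restrict_closed_subinterval[of "\<lambda>t. 1::real" "b - a" a b 0 1]
      has_integral_const_real[of "1::real" a b] ab by (simp add: cbox_interval)
  have "((\<lambda>t. 1 - (if t \<in> {a..b} then 1 else 0)) has_integral 1 - (b - a)) {0..1::real}"
    using has_integral_diff[OF _ L1] has_integral_const_real[of "1::real" 0 1] by simp
  then have L2: "((\<lambda>t. if t \<in> {0..a} \<union> {b..1} then 1 else 0) has_integral 1 - (b - a)) {0..1}"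
    by (rule has_integral_spike_finite[of "{a, b}", rotated 2]) (use ab in auto)
  have "\<forall>\<^sub>F x in F. ?r (\<lambda>s. s \<in> {a..b}) x \<le> (b - a) + e / 2"
    by (rule eventually_proportion_closed_le[OF _ _ _ L1 e2]) (use ab in auto)
  moreover have "\<forall>\<^sub>F x in F. ?r (\<lambda>s. s \<in> {0..a} \<union> {b..1}) x \<le> (1 - (b - a)) + e / 2"
    by (rule eventually_proportion_closed_le[OF _ _ _ L2 e2]) (use ab in \<open>auto intro: compact_Un\<close>)
  ultimately show "\<forall>\<^sub>F x in F. dist (?r (\<lambda>s. s \<in> {a..<b}) x) (b - a) < e"
    using nonempty_A
  proof eventually_elim
    fix x assume 1: "?r (\<lambda>s. s \<in> {a..b}) x \<le> (b - a) + e / 2"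
      and 2: "?r (\<lambda>s. s \<in> {0..a} \<union> {b..1}) x \<le> (1 - (b - a)) + e / 2" and ne: "A x \<noteq> {}"
    have c: "real (card (A x)) > 0" using ne finite_A by (simp add: card_gt_0_iff)
    have "?r (\<lambda>s. s \<in> {a..<b}) x \<le> ?r (\<lambda>s. s \<in> {a..b}) x"
      using finite_A by (intro divide_right_mono of_nat_mono card_mono) auto
    then have upper: "?r (\<lambda>s. s \<in> {a..<b}) x \<le> (b - a) + e / 2" using 1 by linarith
    have "A x = {t \<in> A x. u t \<in> {a..<b}} \<union> {t \<in> A x. u t \<in> {0..a} \<union> {b..1}}"
      using u[of _ x] by (auto simp: not_less) force+
    then have "card (A x) \<le> card {t \<in> A x. u t \<in> {a..<b}} + card {t \<in> A x. u t \<in> {0..a} \<union> {b..1}}"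
      using card_Un_le[of "{t \<in> A x. u t \<in> {a..<b}}" "{t \<in> A x. u t \<in> {0..a} \<union> {b..1}}"] by simp
    then have "real (card (A x)) \<le> real (card {t \<in> A x. u t \<in> {a..<b}})
        + real (card {t \<in> A x. u t \<in> {0..a} \<union> {b..1}})"
      by (simp only: of_nat_le_iff flip: of_nat_add)
    then have "1 \<le> ?r (\<lambda>s. s \<in> {a..<b}) x + ?r (\<lambda>s. s \<in> {0..a} \<union> {b..1}) x"
      using c by (simp add: le_divide_eq flip: add_divide_distrib)
    then show "dist (?r (\<lambda>s. s \<in> {a..<b}) x) (b - a) < e"
      using 2 upper \<open>e > 0\<close> unfolding dist_real_def by linarith
  qed
qed

end

section \<open>Means of exponentials\<close>

lemma laurent_sum_small:
  fixes D :: nat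
  defines "J \<equiv> {- int D..int D} - {0}"
  assumes "\<epsilon> > 0"
  obtains M where "\<And>p k a. prime p \<Longrightarrow> M < p \<Longrightarrow> k \<in> J \<Longrightarrow> \<not> int p dvd a k \<Longrightarrow>
    norm (laurent_sum p J a) \<le> \<epsilon> * real (p - 1)"
proof -
  define K where "K = 2 * D + 1"
  define C where "C = real (D * K ^ K)"
  \<comment> \<open>The assumption that the bound fails will force \<open>p - 1 \<le> R\<close>; the
    2 accounts for \<open>p \<le> 2 (p - 1)\<close>.\<close>
  define R where "R = C * (2 / \<epsilon>) ^ (2 * K)"
  define M where "M = max D (nat \<lceil>R\<rceil> + 1)"
  have "norm (laurent_sum p J a) \<le> \<epsilon> * real (p - 1)"
    if p: "prime p" "M < p" and k: "k \<in> J" "\<not> int p dvd a k" for p k a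
  proof (rule ccontr)
    assume neg: "\<not> norm (laurent_sum p J a) \<le> \<epsilon> * real (p - 1)"
    have p2: "p \<ge> 2" using p(1) by (rule prime_ge_2_nat)
    have pM: "R < real (p - 1)" "D < p"
      using p(2) unfolding M_def by linarith+
    have half: "real p / 2 \<le> real (p - 1)" using p2 by (simp add: of_nat_diff)
    have "\<epsilon> / 2 * real p \<le> \<epsilon> * real (p - 1)"
      using mult_left_mono[OF half, of \<epsilon>] assms(2) by simp
    then have "\<epsilon> / 2 * real p \<le> norm (laurent_sum p J a)" using neg by linarith
    then have "(\<epsilon> / 2 * real p) ^ (2 * K) \<le> norm (laurent_sum p J a) ^ (2 * K)"
      using assms(2) by (intro power_mono) auto
    then have "real (p - 1) * (\<epsilon> / 2 * real p) ^ (2 * K) \<le> real (p - 1) * norm (laurent_sum p J a) ^ (2 * K)"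
      by (intro mult_left_mono) auto
    also have "\<dots> \<le> C * real p ^ (2 * K)"
      using mordell_bound[OF p(1) pM(2), of k a] k unfolding J_def K_def C_def by simp
    finally have "(real (p - 1) * (\<epsilon> / 2) ^ (2 * K)) * real p ^ (2 * K) \<le> C * real p ^ (2 * K)"
      unfolding power_mult_distrib by (simp only: mult.assoc)
    then have "real (p - 1) * (\<epsilon> / 2) ^ (2 * K) \<le> C"
      using p2 by (simp only: mult_le_cancel_right) simp
    then have "real (p - 1) \<le> C / (\<epsilon> / 2) ^ (2 * K)"
      using assms(2) by (intro mult_imp_le_div_pos) auto
    also have "\<dots> = R" by (simp add: R_def power_divide)
    finally show False using pM(1) by simp
  qed
  then show ?thesis by (rule that)
qed

definition value_sum :: "nat set \<Rightarrow> laurent \<Rightarrow> int \<Rightarrow> nat \<Rightarrow> complex" where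
  "value_sum V f k q = (\<Sum>x\<in>unit_funs q V. add_char q (k * laurent_value q x f))"

lemma norm_value_sum_le_card: "norm (value_sum V f k q) \<le> real (card (unit_funs q V))"
  unfolding value_sum_def by (rule order_trans[OF norm_sum]) simp

lemma nonconstant_exponent:
  fixes f :: laurent
  assumes "f \<notin> \<int>"
  shows "\<exists>m\<in>Poly_Mapping.keys f. m \<noteq> 0"
proof (rule ccontr)
  assume "\<not> ?thesis"
  then have 0: "Poly_Mapping.lookup f m = 0" if "m \<noteq> 0" for m
    using that by (auto simp: in_keys_iff)
  have "f = of_int (Poly_Mapping.lookup f 0)"
    by (rule poly_mapping_eqI) (auto simp: lookup_of_int when_def 0)
  then have "f \<in> \<int>" using Ints_of_int by metis
  with assms show False by simp
qed

lemma value_sum_small: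
  assumes "f \<in> laurent_over V" "finite V" "f \<notin> \<int>" "k \<noteq> 0" "\<epsilon> > 0"
  obtains M where "\<And>q. simple_prime_above M q \<Longrightarrow>
    norm (value_sum V f k q) \<le> \<epsilon> * real (card (unit_funs q V))"
proof -
  obtain m0 where m0: "m0 \<in> Poly_Mapping.keys f" "m0 \<noteq> 0"
    using nonconstant_exponent[OF assms(3)] by blast
  obtain w where w: "weighted_degree V w m0 \<noteq> 0" "\<And>m. m \<in> Poly_Mapping.keys f \<Longrightarrow>
      weighted_degree V w m = weighted_degree V w m0 \<Longrightarrow> m = m0"
    using exists_separating_weights[OF assms(1,2) m0] by blast
  define D where "D = nat (\<Sum>m\<in>Poly_Mapping.keys f. \<bar>weighted_degree V w m\<bar>)"
  have D: "\<bar>weighted_degree V w m\<bar> \<le> int D" if "m \<in> Poly_Mapping.keys f" for m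
  proof -
    have "\<bar>weighted_degree V w m\<bar> \<le> (\<Sum>m\<in>Poly_Mapping.keys f. \<bar>weighted_degree V w m\<bar>)"
      using that by (intro member_le_sum) auto
    then show ?thesis by (simp add: D_def)
  qed
  obtain M where M: "\<And>p j a. prime p \<Longrightarrow> M < p \<Longrightarrow> j \<in> {- int D..int D} - {0} \<Longrightarrow> \<not> int p dvd a j \<Longrightarrow>
    norm (laurent_sum p ({- int D..int D} - {0}) a) \<le> \<epsilon> * real (p - 1)"
    using laurent_sum_small[OF assms(5), of D] by blast
  define c where "c = k * Poly_Mapping.lookup f m0"
  have c: "c \<noteq> 0" using assms(4) m0(1) by (simp add: c_def in_keys_iff)
  \<comment> \<open>A prime above \<bar>c\<bar> cannot divide \<open>c\<close>, so the coefficient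
    of \<open>m0\<close> survives modulo \<open>p\<close>.\<close>
  define M' where "M' = max M (nat \<bar>c\<bar>)"
  have "norm (value_sum V f k q) \<le> \<epsilon> * real (card (unit_funs q V))" if q: "simple_prime_above M' q" for q
  proof -
    obtain p r where pr: "prime p" "M' < p" "r > 0" "coprime p r" "q = p * r"
      using q by (auto simp: simple_prime_above_def)
    have p: "M < p" "\<bar>c\<bar> < int p" using pr(2) by (auto simp: M'_def)
    have "\<not> int p dvd c"
      using c p(2) zdvd_imp_le[of "int p" "\<bar>c\<bar>"] by auto
    then have "real (p - 1) * norm (\<Sum>x\<in>unit_funs (p * r) V. add_char (p * r) (k * laurent_value (p * r) x f))
        \<le> real (card (unit_funs (p * r) V)) * (\<epsilon> * real (p - 1))"
      unfolding c_def
      by (intro norm_value_sum_le[OF assms(1,2) pr(1,3,4) D m0(1) w] M pr(1) p(1))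
    then have "real (p - 1) * norm (value_sum V f k q) \<le> real (p - 1) * (\<epsilon> * real (card (unit_funs q V)))"
      by (simp add: value_sum_def pr(5) mult_ac)
    moreover have "real (p - 1) > 0" using prime_gt_1_nat[OF pr(1)] by simp
    ultimately show ?thesis by (simp only: mult_le_cancel_left_pos)
  qed
  then show ?thesis by (rule that)
qed

text \<open>Moduli without a suitable prime are estimated trivially by \<open>N ^ card V\<close>;
  only their number matters.\<close>

lemma norm_sum_value_sum_le:
  assumes "finite V" "0 < M" "\<epsilon> > 0"
    and "\<And>q. simple_prime_above M q \<Longrightarrow> norm (value_sum V f k q) \<le> \<epsilon> * real (card (unit_funs q V))"
  shows "norm (\<Sum>q\<in>{1..N}. value_sum V f k q)
      \<le> \<epsilon> * (\<Sum>q\<in>{1..N}. real (card (unit_funs q V)))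
         + (real N / real M + 2 ^ Suc M * sqrt (real N)) * real N ^ card V"
proof -
  define B where "B = {q \<in> {1..N}. \<not> simple_prime_above M q}"
  have B: "finite B" "B \<subseteq> {1..N}" by (auto simp: B_def)
  have "norm (\<Sum>q\<in>{1..N}. value_sum V f k q)
      \<le> (\<Sum>q\<in>{1..N}. \<epsilon> * real (card (unit_funs q V)) + (if q \<in> B then real N ^ card V else 0))"
  proof (rule sum_norm_le)
    fix q assume q: "q \<in> {1..N}"
    show "norm (value_sum V f k q) \<le> \<epsilon> * real (card (unit_funs q V)) + (if q \<in> B then real N ^ card V else 0)"
    proof (cases "q \<in> B")
      case True
      have "norm (value_sum V f k q) \<le> real (card (unit_funs q V))" by (rule norm_value_sum_le_card)
      also have "\<dots> \<le> real (q ^ card V)"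
        using card_unit_funs_le[OF assms(1), of q] by (simp only: of_nat_le_iff)
      also have "\<dots> \<le> real N ^ card V" using q by (simp add: power_mono)
      also have "\<dots> \<le> \<epsilon> * real (card (unit_funs q V)) + real N ^ card V"
        using assms(3) by simp
      finally show ?thesis using True by simp
    next
      case False
      then have "simple_prime_above M q" using q by (simp add: B_def)
      from assms(4)[OF this] False show ?thesis by simp
    qed
  qed
  also have "\<dots> = \<epsilon> * (\<Sum>q\<in>{1..N}. real (card (unit_funs q V))) + real (card B) * real N ^ card V"
    using B by (simp add: sum.distrib sum_distrib_left sum.If_cases Int_absorb1)
  also have "real (card B) * real N ^ card V
      \<le> (real N / real M + 2 ^ Suc M * sqrt (real N)) * real N ^ card V"
    unfolding B_def by (intro mult_right_mono card_no_simple_prime_above_le assms(2)) simp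
  finally show ?thesis by simp
qed

lemma value_sum_ratio_tendsto_0:
  assumes "f \<in> laurent_over V" "finite V" "f \<notin> \<int>" "k \<noteq> 0"
  shows "(\<lambda>N. (\<Sum>q\<in>{1..N}. value_sum V f k q) / of_nat (\<Sum>q\<in>{1..N}. card (unit_funs q V))) \<longlonglongrightarrow> 0"
proof (rule tendstoI)
  fix e :: real assume e: "e > 0"
  define Z where "Z N = (\<Sum>q\<in>{1..N}. real (card (unit_funs q V)))" for N
  \<comment> \<open>This collects the constants 1/8 and 1/32 of
    \<open>sum_card_unit_funs_ge\<close>.\<close>
  define c :: real where "c = 1 / (8 * 32 ^ card V)"
  have c: "c > 0" by (simp add: c_def)
  have Z: "c * (real N * real N ^ card V) \<le> Z N" if "N \<ge> 8" for N
    using sum_card_unit_funs_ge[OF assms(2) that] by (simp add: Z_def c_def power_divide)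
  obtain M0 where M0: "\<And>q. simple_prime_above M0 q \<Longrightarrow>
      norm (value_sum V f k q) \<le> e / 2 * real (card (unit_funs q V))"
    using value_sum_small[OF assms, of "e / 2"] e by auto
  \<comment> \<open>\<open>M\<close> is fixed before \<open>N\<close> grows: it makes the term
    \<open>N / M\<close> at most \<open>e c N / 8\<close>, while the square root term needs large
    \<open>N\<close>. The total is then at most \<open>e/2 + e/4\<close> of the main term.\<close>
  define M where "M = max M0 (nat \<lceil>8 / (e * c)\<rceil> + 1)"
  have M: "M > 0" "8 / (e * c) \<le> real M" unfolding M_def by linarith+
  have "simple_prime_above M q \<Longrightarrow> simple_prime_above M0 q" for q
    by (auto simp: simple_prime_above_def M_def)
  note bound = norm_sum_value_sum_le[OF assms(2) M(1), of "e / 2" f k, OF _ M0[OF this]]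
  have "(\<lambda>N. 2 ^ Suc M * (1 / sqrt (real N))) \<longlonglongrightarrow> 2 ^ Suc M * 0"
    by (intro tendsto_mult tendsto_const) real_asymp
  then have "\<forall>\<^sub>F N in sequentially. 2 ^ Suc M * (1 / sqrt (real N)) < e * c / 8"
    using e c by (intro order_tendstoD(2)) auto
  then show "\<forall>\<^sub>F N in sequentially. dist ((\<Sum>q\<in>{1..N}. value_sum V f k q)
      / of_nat (\<Sum>q\<in>{1..N}. card (unit_funs q V))) 0 < e"
    using eventually_ge_at_top[of 8]
  proof eventually_elim
    fix N assume N1: "2 ^ Suc M * (1 / sqrt (real N)) < e * c / 8" and N: "N \<ge> (8::nat)"
    have N0: "real N > 0" using N by simp
    have "real N / real M \<le> e * c / 8 * real N"
    proof -
      have "1 / real M \<le> e * c / 8"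
        using M e c by (simp add: field_simps)
      from mult_right_mono[OF this, of "real N"] show ?thesis by simp
    qed
    moreover have "2 ^ Suc M * sqrt (real N) \<le> e * c / 8 * real N"
    proof -
      have "2 ^ Suc M * sqrt (real N) = 2 ^ Suc M * (1 / sqrt (real N)) * real N"
        using N0 by (simp add: real_div_sqrt field_simps flip: power2_eq_square)
      also have "\<dots> \<le> e * c / 8 * real N"
        using N1 by (intro mult_right_mono) auto
      finally show ?thesis .
    qed
    ultimately have "real N / real M + 2 ^ Suc M * sqrt (real N) \<le> e * c / 4 * real N"
      by linarith
    then have "(real N / real M + 2 ^ Suc M * sqrt (real N)) * real N ^ card V
        \<le> e * c / 4 * real N * real N ^ card V"
      by (intro mult_right_mono) auto
    also have "\<dots> = e / 4 * (c * (real N * real N ^ card V))" by simp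
    also have "\<dots> \<le> e / 4 * Z N"
      using Z[OF N] e by (intro mult_left_mono) auto
    finally have "norm (\<Sum>q\<in>{1..N}. value_sum V f k q) \<le> e / 2 * Z N + e / 4 * Z N"
      using bound[of N] e unfolding Z_def by linarith
    moreover have "Z N > 0"
      using Z[OF N] c N0 by (meson less_le_trans mult_pos_pos zero_less_power)
    ultimately have "norm (\<Sum>q\<in>{1..N}. value_sum V f k q) < e * Z N"
      using mult_pos_pos[OF e \<open>Z N > 0\<close>] by linarith
    then show "dist ((\<Sum>q\<in>{1..N}. value_sum V f k q) / of_nat (\<Sum>q\<in>{1..N}. card (unit_funs q V))) 0 < e"
      using \<open>Z N > 0\<close> by (simp add: norm_divide Z_def divide_less_eq flip: of_nat_sum)
  qed
qed

text \<open>For integers the strict bound \<open>q < x\<close> means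
  \<open>q \<le> \<lceil>x\<rceil> - 1\<close>, and truncation to 0 gives the empty range when
  \<open>x \<le> 1\<close>.\<close>

lemma I_below_eq_Sigma:
  "I_below n x = (SIGMA q:{1..nat (\<lceil>x\<rceil> - 1)}. unit_funs q {1..<n})"
proof -
  have "0 < q \<and> real q < x \<longleftrightarrow> q \<in> {1..nat (\<lceil>x\<rceil> - 1)}" for q :: nat
    by (auto simp: nat_le_iff less_ceiling_iff Suc_le_eq) linarith+
  moreover have "(q, p) \<in> I_below n x \<longleftrightarrow> (0 < q \<and> real q < x) \<and> p \<in> unit_funs q {1..<n}" for q p
    unfolding I_below_def I_set_def unit_funs_def PiE_iff by auto
  ultimately show ?thesis by auto
qed

lemma filterlim_nat_ceiling_minus_1: "filterlim (\<lambda>x::real. nat (\<lceil>x\<rceil> - 1)) sequentially at_top"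
  unfolding filterlim_at_top
proof
  fix N :: nat
  show "\<forall>\<^sub>F x in at_top. N \<le> nat (\<lceil>x::real\<rceil> - 1)"
    using eventually_ge_at_top[of "real N + 1"] by eventually_elim linarith
qed

lemma cis_eq_add_char:
  assumes "q > 0"
  shows "cis (2 * pi * of_int k * frac (of_int v / real q)) = add_char q (k * v)"
proof -
  have "2 * pi * of_int k * frac (of_int v / real q)
      = 2 * pi * of_int (k * v) / real q - 2 * pi * of_int (k * \<lfloor>of_int v / real q\<rfloor>)"
    by (simp add: frac_def algebra_simps)
  then show ?thesis
    by (simp add: add_char_def flip: cis_divide)
qed

lemma exp_eq_add_char:
  "exp (2 * of_real pi * \<i> * of_int k / of_nat q * of_int v) = add_char q (k * v)"
  by (simp add: add_char_def cis_conv_exp mult_ac)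

lemma sum_I_below:
  "(\<Sum>(q, p)\<in>I_below n x. g q p) = (\<Sum>q\<in>{1..nat (\<lceil>x\<rceil> - 1)}. \<Sum>p\<in>unit_funs q {1..<n}. g q p)"
  unfolding I_below_eq_Sigma by (intro sum.Sigma[symmetric]) (simp_all add: finite_unit_funs)

lemma card_I_below:
  "card (I_below n x) = (\<Sum>q\<in>{1..nat (\<lceil>x\<rceil> - 1)}. card (unit_funs q {1..<n}))"
  unfolding I_below_eq_Sigma by (simp add: finite_unit_funs)

lemma exponential_mean_tendsto_0:
  assumes "f \<in> laurent_over {1..<n}" "f \<notin> \<int>" "k \<noteq> 0"
  shows "((\<lambda>x. (\<Sum>(q, p)\<in>I_below n x. add_char q (k * laurent_value q p f))
            / of_nat (card (I_below n x))) \<longlongrightarrow> 0) at_top"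
  using filterlim_compose[OF value_sum_ratio_tendsto_0[OF assms(1) _ assms(2,3)] filterlim_nat_ceiling_minus_1]
  by (simp add: sum_I_below card_I_below value_sum_def)

text \<open>Constants are excluded explicitly because a nonzero constant satisfies (H) with degree
  0, whereas its exponentials tend to 1 as \<open>q\<close> grows.\<close>

theorem proposition6p2:
  fixes n :: nat and f :: laurent
  assumes f_over: "f \<in> laurent_over {1..<n}"
    and H: "\<exists>i \<in> {1..<n}. laurent_monomial (lead_coeff_wrt i f)"
    and nonconst: "f \<notin> \<int>"
  shows "equidistributed (I_below n) (\<lambda>(q, p). frac (real_of_int (laurent_value q p f) / real q)) \<and>
    (\<forall>k::int. k \<noteq> 0 \<longrightarrow>
      ((\<lambda>x::real. 1 / of_nat (card (I_below n x)) *
          (\<Sum>(q, p) \<in> I_below n x.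
             exp (2 * of_real pi * \<i> * of_int k / of_nat q * of_int (laurent_value q p f))))
        \<longlongrightarrow> (0::complex)) at_top)"
proof
  let ?u = "\<lambda>(q, p). frac (real_of_int (laurent_value q p f) / real q)"
  interpret weyl_means "I_below n" ?u at_top
  proof
    show "\<forall>\<^sub>F x in at_top. I_below n x \<noteq> {}"
      using eventually_gt_at_top[of "2::real"]
    proof eventually_elim
      fix x :: real assume "2 < x"
      \<comment> \<open>The tuple \<open>(2; 1, ..., 1)\<close> is admissible for every
        \<open>n\<close>.\<close>
      then have "(2, \<lambda>i\<in>{1..<n}. 1) \<in> I_below n x"
        by (auto simp: I_below_def I_set_def)
      then show "I_below n x \<noteq> {}" by blast
    qed
    fix k :: int assume k: "k \<noteq> 0"
    have "(\<Sum>t\<in>I_below n x. cis (2 * pi * of_int k * ?u t))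
        = (\<Sum>(q, p)\<in>I_below n x. add_char q (k * laurent_value q p f))" for x
      by (intro sum.cong refl) (auto simp: cis_eq_add_char I_below_def I_set_def)
    then show "((\<lambda>x. (\<Sum>t\<in>I_below n x. cis (2 * pi * of_int k * ?u t)) / of_nat (card (I_below n x))) \<longlongrightarrow> 0) at_top"
      using exponential_mean_tendsto_0[OF f_over nonconst k] by simp
  qed (rule finite_I_below)
  show "equidistributed (I_below n) ?u"
    unfolding equidistributed_def
    by (intro allI impI weyl_criterion) (auto simp: frac_lt_1)
  show "\<forall>k::int. k \<noteq> 0 \<longrightarrow>
      ((\<lambda>x::real. 1 / of_nat (card (I_below n x)) *
          (\<Sum>(q, p) \<in> I_below n x.
             exp (2 * of_real pi * \<i> * of_int k / of_nat q * of_int (laurent_value q p f))))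
        \<longlongrightarrow> (0::complex)) at_top"
    unfolding exp_eq_add_char
    using exponential_mean_tendsto_0[OF f_over nonconst] by simp
qed

end
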